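(* Let $\Gamma=(G,\sigma)$ be a signed graph with $G=(V,E)$, $|V|=n$. Let $1\le m\le n-1$ and let $\Gamma'=(G',\sigma)$, where $G'=(V',E')$ is the induced subgraph of $G$ obtained by removing $m$ vertices from $V$ (with $\sigma,w,\mu,\kappa$ restricted). Then for every $1\le k\le n-m$, $$L_k(\Gamma)\le L_k(\Gamma')\le L_{k+m}(\Gamma).$$
   Context: $G=(V,E)$ is a finite undirected graph without self-loops, $V=\{1,\dots,n\}$. A signed graph $\Gamma=(G,\sigma)$ has signature $\sigma:E\to\{\pm1\}$, $\sigma_{ij}=\sigma(\{i,j\})$, edge weight $w:E\to(0,\infty)$, vertex measure $\mu:V\to(0,\infty)$, potential $\kappa:V\to\mathbb R$. For $p\ge1$ and nonzero $f$, $\mathcal R_p^\sigma(f)=\frac{\sum_{\{i,j\}\in E}w_{ij}|f(i)-\sigma_{ij}f(j)|^p+\sum_i\kappa_i|f(i)|^p}{\sum_i\mu_i|f(i)|^p}$; $\mathcal S_p=\{f:\sum_i\mu_i|f(i)|^p=1\}$. The Krasnoselskii genus $\gamma(B)$ of a closed symmetric $B\subset\mathbb R^n\setminus\{0\}$ is the least $k$ with an odd continuous map $B\to\mathbb R^k\setminus\{0\}$; $\mathcal F_k(\mathcal S_p)$ = closed symmetric $B\subset\mathcal S_p$ with $\gamma(B)\ge k$. Variational eigenvalues: $\lambda_k^{(p)}(\Gamma)=\min_{B\in\mathcal F_k(\mathcal S_p)}\max_{f\in B}\mathcal R_p^\sigma(f)$. Cut-off adjacency eigenvalues: $L_k(\Gamma):=\lim_{p\to\infty}2^{-p}\lambda_k^{(p)}(\Gamma)$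 (the limits exist and are independent of $\kappa$); for a graph on $N$ vertices these are defined for $k=1,\dots,N$. *)

theory Defs
  imports "HOL-Analysis.Analysis"
begin

text \<open>A weighted signed graph on a finite vertex set V.  The edge set is given by a
symmetric irreflexive adjacency relation A on V; signature sigma and edge weight w are
symmetric functions on pairs (only their values on edges matter); mu is the vertex measure,
kappa the potential.\<close>

definition signed_graph ::
  "'a set \<Rightarrow> ('a \<Rightarrow> 'a \<Rightarrow> bool) \<Rightarrow> ('a \<Rightarrow> 'a \<Rightarrow> real) \<Rightarrow> ('a \<Rightarrow> 'a \<Rightarrow> real) \<Rightarrow> ('a \<Rightarrow> real) \<Rightarrow> bool" where
  "signed_graph V A \<sigma> w \<mu> \<longleftrightarrow>
     finite V \<and>
     (\<forall>i j. A i j \<longrightarrow> i \<in> V \<and> j \<in> V \<and> i \<noteq> j \<and> A j i) \<and>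
     (\<forall>i j. A i j \<longrightarrow> (\<sigma> i j = 1 \<or> \<sigma> i j = -1) \<and> \<sigma> i j = \<sigma> j i \<and> w i j > 0 \<and> w i j = w j i) \<and>
     (\<forall>i\<in>V. \<mu> i > 0)"

text \<open>Real functions on V (extended by 0 outside V); this is R^V.\<close>
definition fspace :: "'a set \<Rightarrow> ('a \<Rightarrow> real) set" where
  "fspace V = {f. \<forall>x. x \<notin> V \<longrightarrow> f x = 0}"

text \<open>Energy: sum over unordered edges {i,j} of w_ij |f i - sigma_ij f j|^p, written as half
the sum over ordered adjacent pairs (the summand is symmetric), plus the potential term.\<close>
definition energy ::
  "'a set \<Rightarrow> ('a \<Rightarrow> 'a \<Rightarrow> bool) \<Rightarrow> ('a \<Rightarrow> 'a \<Rightarrow> real) \<Rightarrow> ('a \<Rightarrow> 'a \<Rightarrow> real) \<Rightarrow> ('a \<Rightarrow> real)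
    \<Rightarrow> real \<Rightarrow> ('a \<Rightarrow> real) \<Rightarrow> real" where
  "energy V A \<sigma> w \<kappa> p f =
     (1/2) * (\<Sum>i\<in>V. \<Sum>j\<in>V. if A i j then w i j * \<bar>f i - \<sigma> i j * f j\<bar> powr p else 0)
     + (\<Sum>i\<in>V. \<kappa> i * \<bar>f i\<bar> powr p)"

definition pnorm_mu :: "'a set \<Rightarrow> ('a \<Rightarrow> real) \<Rightarrow> real \<Rightarrow> ('a \<Rightarrow> real) \<Rightarrow> real" where
  "pnorm_mu V \<mu> p f = (\<Sum>i\<in>V. \<mu> i * \<bar>f i\<bar> powr p)"

definition rayleigh ::
  "'a set \<Rightarrow> ('a \<Rightarrow> 'a \<Rightarrow> bool) \<Rightarrow> ('a \<Rightarrow> 'a \<Rightarrow> real) \<Rightarrow> ('a \<Rightarrow> 'a \<Rightarrow> real) \<Rightarrow> ('a \<Rightarrow> real)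
    \<Rightarrow> ('a \<Rightarrow> real) \<Rightarrow> real \<Rightarrow> ('a \<Rightarrow> real) \<Rightarrow> real" where
  "rayleigh V A \<sigma> w \<mu> \<kappa> p f = energy V A \<sigma> w \<kappa> p f / pnorm_mu V \<mu> p f"

definition psphere :: "'a set \<Rightarrow> ('a \<Rightarrow> real) \<Rightarrow> real \<Rightarrow> ('a \<Rightarrow> real) set" where
  "psphere V \<mu> p = {f \<in> fspace V. pnorm_mu V \<mu> p f = 1}"

text \<open>R^j realised as the finitely supported sequences supported in {..<j}
(with the product topology this is Euclidean j-space).\<close>
definition Rspace :: "nat \<Rightarrow> (nat \<Rightarrow> real) set" where
  "Rspace j = {v. \<forall>i\<ge>j. v i = 0}"

text \<open>Krasnoselskii genus at least k: there is no odd continuous map B \<rightarrow> R^j minus {0}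
for any j < k (so the least such j, if any, is \<ge> k).\<close>
definition genus_ge :: "('a \<Rightarrow> real) set \<Rightarrow> nat \<Rightarrow> bool" where
  "genus_ge B k \<longleftrightarrow>
     \<not> (\<exists>j<k. \<exists>g :: ('a \<Rightarrow> real) \<Rightarrow> (nat \<Rightarrow> real).
            continuous_on B g \<and> (\<forall>x\<in>B. g (\<lambda>i. - x i) = (\<lambda>i. - g x i)) \<and> (\<forall>x\<in>B. g x \<in> Rspace j - {\<lambda>_. 0}))"

definition genus_family :: "'a set \<Rightarrow> ('a \<Rightarrow> real) \<Rightarrow> real \<Rightarrow> nat \<Rightarrow> ('a \<Rightarrow> real) set set" where
  "genus_family V \<mu> p k =
     {B. B \<subseteq> psphere V \<mu> p \<and> closed B \<and> (\<forall>f\<in>B. (\<lambda>i. - f i) \<in> B) \<and> genus_ge B k}"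

text \<open>Variational eigenvalue (min-max; the min and max are attained, so Inf/Sup coincide with them).\<close>
definition var_eig ::
  "'a set \<Rightarrow> ('a \<Rightarrow> 'a \<Rightarrow> bool) \<Rightarrow> ('a \<Rightarrow> 'a \<Rightarrow> real) \<Rightarrow> ('a \<Rightarrow> 'a \<Rightarrow> real) \<Rightarrow> ('a \<Rightarrow> real)
    \<Rightarrow> ('a \<Rightarrow> real) \<Rightarrow> real \<Rightarrow> nat \<Rightarrow> real" where
  "var_eig V A \<sigma> w \<mu> \<kappa> p k =
     (INF B \<in> genus_family V \<mu> p k. SUP f \<in> B. rayleigh V A \<sigma> w \<mu> \<kappa> p f)"

definition cutoff_eig ::
  "'a set \<Rightarrow> ('a \<Rightarrow> 'a \<Rightarrow> bool) \<Rightarrow> ('a \<Rightarrow> 'a \<Rightarrow> real) \<Rightarrow> ('a \<Rightarrow> 'a \<Rightarrow> real) \<Rightarrow> ('a \<Rightarrow> real)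
    \<Rightarrow> ('a \<Rightarrow> real) \<Rightarrow> nat \<Rightarrow> real" where
  "cutoff_eig V A \<sigma> w \<mu> \<kappa> k =
     Lim at_top (\<lambda>p::real. 2 powr (- p) * var_eig V A \<sigma> w \<mu> \<kappa> p k)"

definition induced :: "('a \<Rightarrow> 'a \<Rightarrow> bool) \<Rightarrow> 'a set \<Rightarrow> 'a \<Rightarrow> 'a \<Rightarrow> bool" where
  "induced A V' = (\<lambda>i j. A i j \<and> i \<in> V' \<and> j \<in> V')"

end

theory Submission
  imports Defs "HOL-Homology.Homology"
begin

text \<open>
  Call an edge \<open>{i, j}\<close> frustrated by \<open>f\<close> if \<open>\<sigma> i j * f i * f j < 0\<close>.  On the unit \<open>p\<close>-sphere,
  \<open>2 powr (- p)\<close> times the Rayleigh quotient differs by \<open>O(2 powr (- p))\<close> from the energy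
  \<open>\<Sum> w i j * ((\<bar>f i\<bar> + \<bar>f j\<bar>) / 2) powr p\<close> over the frustrated edges: all other edges and the potential
  contribute a bounded amount to the quotient.  The odd homeomorphism
  \<open>f i \<mapsto> sgn (f i) * \<bar>f i\<bar> powr (p / q)\<close> from the \<open>p\<close>-sphere to the \<open>q\<close>-sphere turns the summands into power
  means of exponent \<open>1 / p\<close>, which decrease in \<open>p\<close>; so the min-max values of this energy
  decrease to a limit, which is the cut-off eigenvalue.

  Both inequalities then hold for the frustrated energy at every \<open>p\<close>, because an edge at a zero of
  \<open>f\<close> is never frustrated.  The first is extension by zero.  For the second, intersecting a set with
  the \<open>m\<close> hyperplanes \<open>f v = 0\<close> lowers the genus by at most \<open>m\<close>, by Tietze extension.

  The families of sets in the min-max must be nonempty, which is the Borsuk-Ulam theorem.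
  The sphere carries chains \<open>c\<^sub>0, \<dots>, c\<^sub>n\<close> with \<open>\<partial>c\<^sub>i\<^sub>+\<^sub>1 = c\<^sub>i \<plusminus> T c\<^sub>i\<close>, \<open>T\<close> the antipodal map, since its
  homology vanishes below the top degree.  After subdivision, an odd map to \<open>\<real>\<^sup>n - {0}\<close> labels the vertices
  by \<open>\<plusminus>1, \<dots>, \<plusminus>n\<close> without opposite labels in a simplex, and Fan's count of alternating
  simplices in \<open>c\<^sub>i + T c\<^sub>i\<close> has the same parity for all \<open>i\<close>: odd for \<open>i = 0\<close>, zero for \<open>i = n\<close>.
\<close>

subsection \<open>Alternating label lists\<close>

fun alternating :: "bool \<Rightarrow> bool list \<Rightarrow> bool" where
  "alternating s [] \<longleftrightarrow> True"
| "alternating s (b # bs) \<longleftrightarrow> b = s \<and> alternating (\<not> s) bs"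

definition delete_nth :: "nat \<Rightarrow> 'a list \<Rightarrow> 'a list" where
  "delete_nth i xs = take i xs @ drop (Suc i) xs"

lemma delete_nth_0 [simp]: "delete_nth 0 (x # xs) = xs"
  and delete_nth_Suc [simp]: "delete_nth (Suc i) (x # xs) = x # delete_nth i xs"
  by (simp_all add: delete_nth_def)

lemma map_delete_nth: "map f (delete_nth i xs) = delete_nth i (map f xs)"
  by (simp add: delete_nth_def take_map drop_map)

lemma mset_delete_nth:
  assumes "i < length xs"
  shows "mset (delete_nth i xs) = mset xs - {#xs ! i#}"
proof -
  have "mset xs = mset (take i xs @ xs ! i # drop (Suc i) xs)"
    using assms id_take_nth_drop by metis
  then show ?thesis
    by (simp add: delete_nth_def)
qed

lemma set_delete_nth: "set (delete_nth i xs) \<subseteq> set xs"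
  by (auto simp: delete_nth_def dest: in_set_takeD in_set_dropD)

lemma sorted_delete_nth: "sorted xs \<Longrightarrow> sorted (delete_nth i xs)"
proof (induction xs arbitrary: i)
  case Nil
  then show ?case by (simp add: delete_nth_def)
next
  case (Cons x xs)
  then show ?case
    using set_delete_nth[of _ xs] by (cases i) auto
qed

text \<open>Induction on the list. Deleting the head leaves the tail, tested with start
  \<open>s\<close>; deleting a later entry keeps the head, so it contributes only if
  \<open>b = s\<close>, and the tail is then tested with start \<open>\<not> s\<close>. This is why
  \<open>s\<close> varies in the induction.\<close>

lemma even_sum_alternating_delete_nth:
  "even ((\<Sum>i<length bs. of_bool (alternating s (delete_nth i bs))) +
         of_bool (alternating True bs) + of_bool (alternating False bs) :: int)"
proof (induction bs arbitrary: s)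
  case Nil
  then show ?case by simp
next
  case (Cons b bs)
  have "(\<Sum>i<length (b # bs). of_bool (alternating s (delete_nth i (b # bs)))) =
      (of_bool (alternating s bs) :: int) +
        of_bool (b = s) * (\<Sum>i<length bs. of_bool (alternating (\<not> s) (delete_nth i bs)))"
    by (simp add: sum.lessThan_Suc_shift sum_distrib_left del: sum.lessThan_Suc)
  then show ?case
    using Cons.IH[of "\<not> s"] by (cases s; cases b) auto
qed

text \<open>The label \<open>\<plusminus>(a + 1)\<close> is encoded as \<open>2 * a\<close> or \<open>2 * a + 1\<close>, so that sorting orders labels by absolute
  value and parity is the sign.\<close>

definition opp_label :: "nat \<Rightarrow> nat" where
  "opp_label l = (if even l then Suc l else l - 1)"

lemma even_opp_label [simp]: "even (opp_label l) \<longleftrightarrow> odd l"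
  by (auto simp: opp_label_def elim: oddE)

lemma opp_label_opp_label [simp]: "opp_label (opp_label l) = l"
  by (auto simp: opp_label_def elim: oddE)

lemma opp_label_div2 [simp]: "opp_label l div 2 = l div 2"
  by (auto simp: opp_label_def elim: oddE)

lemma div2_eq_iff: "a div 2 = b div 2 \<longleftrightarrow> a = b \<or> a = opp_label b" for a b :: nat
  by (cases "even a"; cases "even b") (auto elim!: evenE oddE simp: opp_label_def)

section \<open>Label sets without opposite pairs, and Fan's cochain\<close>

definition opposite_free :: "nat set \<Rightarrow> bool" where
  "opposite_free L \<longleftrightarrow> (\<forall>a\<in>L. opp_label a \<notin> L)"

lemma opposite_free_subset: "opposite_free L \<Longrightarrow> M \<subseteq> L \<Longrightarrow> opposite_free M"
  by (auto simp: opposite_free_def)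

lemma opposite_free_image_opp_label [simp]: "opposite_free (opp_label ` L) \<longleftrightarrow> opposite_free L"
  by (force simp: opposite_free_def)

text \<open>Two labels of the same absolute value in an opposite-free set are equal; otherwise the
  absolute value \<open>div 2\<close>, which \<open>opp_label\<close> preserves, decides the
  order.\<close>

lemma opp_label_mono:
  assumes "opposite_free L" "a \<in> L" "b \<in> L" "a \<le> b"
  shows "opp_label a \<le> opp_label b"
proof (cases "a div 2 = b div 2")
  case True
  then have "a = b"
    using assms by (auto simp: div2_eq_iff opposite_free_def)
  then show ?thesis by simp
next
  case False
  then have "a div 2 < b div 2"
    using assms(4) by (simp add: div_le_mono le_neq_implies_less)
  then have "opp_label a div 2 < opp_label b div 2"
    by simp
  then show ?thesis
    by (meson div_le_mono leD linorder_le_cases)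
qed

lemma sorted_map_opp_label:
  assumes "opposite_free (set L)" "sorted L"
  shows "sorted (map opp_label L)"
  using assms(2) opp_label_mono[OF assms(1)]
  by (auto simp: sorted_wrt_map intro: sorted_wrt_mono_rel[of L "(\<le>)"])

lemma alternating_map_odd: "alternating s (map odd L) = alternating (\<not> s) (map even L)"
  by (induction L arbitrary: s) auto

text \<open>Indicator of the simplices that Fan counts: ordered by absolute value, the signs
  alternate, beginning with a positive (even) label.\<close>

definition fan_cochain :: "nat list \<Rightarrow> int" where
  "fan_cochain L = of_bool (alternating True (map even (sort L)))"

text \<open>Opposite-freeness makes sorting commute with \<open>opp_label\<close>, so negating all
  labels only exchanges the two starting signs.\<close>

lemma fan_opp_label:
  assumes "opposite_free (set L)"
  shows "fan_cochain (map opp_label L) = of_bool (alternating False (map even (sort L)))"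
proof -
  have "sort (map opp_label L) = map opp_label (sort L)"
    using assms by (intro properties_for_sort) (auto intro!: sorted_map_opp_label)
  then show ?thesis
    using alternating_map_odd[of True "sort L"] by (simp add: fan_cochain_def comp_def)
qed

text \<open>\<open>fan_cochain\<close> depends only on the multiset of labels, so the faces of
  \<open>L\<close> may be replaced by those of \<open>sort L\<close>, which are already
  sorted.\<close>

lemma sum_fan_delete_nth:
  "(\<Sum>i<length L. fan_cochain (delete_nth i L)) =
   (\<Sum>i<length L. of_bool (alternating True (delete_nth i (map even (sort L)))))"
proof -
  define h :: "nat multiset \<Rightarrow> int" where "h M = (of_bool (alternating True (map even (sorted_list_of_multiset M))) :: int)" for M
  have fan_cochain: "fan_cochain xs = h (mset xs)" for xs
    by (simp add: fan_cochain_def h_def sorted_list_of_multiset_mset)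
  have *: "(\<Sum>i<length xs. fan_cochain (delete_nth i xs)) = (\<Sum>x\<in>#mset xs. h (mset xs - {#x#}))" for xs
  proof -
    have "(\<Sum>i<length xs. fan_cochain (delete_nth i xs)) = (\<Sum>i<length xs. h (mset xs - {#xs ! i#}))"
      by (intro sum.cong) (auto simp: fan_cochain mset_delete_nth)
    also have "\<dots> = sum_list (map (\<lambda>x. h (mset xs - {#x#})) xs)"
      by (simp add: sum_list_sum_nth atLeast0LessThan)
    finally show ?thesis
      by (simp flip: mset_map sum_mset_sum_list)
  qed
  have "(\<Sum>i<length L. fan_cochain (delete_nth i L)) = (\<Sum>i<length (sort L). fan_cochain (delete_nth i (sort L)))"
    unfolding * by simp
  also have "\<dots> = (\<Sum>i<length L. of_bool (alternating True (delete_nth i (map even (sort L)))))"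
    by (intro sum.cong)
      (auto simp: fan_cochain_def map_delete_nth sorted_sort_id sorted_delete_nth)
  finally show ?thesis .
qed

text \<open>Modulo 2, the coboundary of Fan's cochain is the cochain plus its antipodal pull-back: a
  list alternating from a negative sign is one that is counted after negation.\<close>

lemma fan_boundary:
  assumes "opposite_free (set L)"
  shows "even ((\<Sum>i<length L. fan_cochain (delete_nth i L)) + fan_cochain L + fan_cochain (map opp_label L))"
  using even_sum_alternating_delete_nth[of True "map even (sort L)"]
  unfolding sum_fan_delete_nth fan_opp_label[OF assms] by (simp only: fan_cochain_def length_map length_sort)

text \<open>Neighbours in an alternating list differ in sign, hence are distinct; not being opposite
  either, they differ in absolute value.\<close>

lemma distinct_div2_if_alternating:
  assumes "sorted L" "opposite_free (set L)" "alternating s (map even L)"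
  shows "sorted_wrt (\<lambda>a b. a div 2 < b div 2) L"
  using assms
proof (induction L arbitrary: s)
  case Nil
  then show ?case by simp
next
  case (Cons a L)
  have IH: "sorted_wrt (\<lambda>a b. a div 2 < b div 2) L"
    using Cons by (auto intro: opposite_free_subset)
  show ?case
  proof (cases L)
    case (Cons b M)
    have "a \<le> b" "even a \<noteq> even b" "opp_label b \<noteq> a"
      using Cons.prems Cons by (auto simp: opposite_free_def)
    then have "a div 2 \<noteq> b div 2"
      by (auto simp: div2_eq_iff)
    then have "a div 2 < b div 2"
      using \<open>a \<le> b\<close> by (simp add: div_le_mono le_neq_implies_less)
    then show ?thesis
      using IH Cons by fastforce
  qed simp
qed

text \<open>Pigeonhole: an alternating list has pairwise different absolute values, of which only
  \<open>n\<close> are available.\<close>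

lemma fan_eq_0:
  assumes "opposite_free (set L)" "set L \<subseteq> {..<2 * n}" "n < length L"
  shows "fan_cochain L = 0"
proof (rule ccontr)
  assume "fan_cochain L \<noteq> 0"
  then have "alternating True (map even (sort L))"
    by (auto simp: fan_cochain_def)
  then have "sorted_wrt (\<lambda>a b. a div 2 < b div 2) (sort L)"
    using assms by (intro distinct_div2_if_alternating) auto
  then have "distinct (map (\<lambda>a. a div 2) (sort L))"
    by (metis (mono_tags, lifting) sorted_wrt_map sorted_wrt_mono_rel strict_sorted_iff)
  then have "length L = card (set (map (\<lambda>a. a div 2) (sort L)))"
    by (simp add: distinct_card del: set_map)
  also have "\<dots> \<le> card {..<n}"
    using assms(2) by (intro card_mono) auto
  finally show False
    using assms(3) by simp
qed

subsection \<open>Equivariant chains and the Borsuk-Ulam theorem\<close>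

definition vertex_labels :: "nat \<Rightarrow> ('a \<Rightarrow> nat) \<Rightarrow> ((nat \<Rightarrow> real) \<Rightarrow> 'a) \<Rightarrow> nat list" where
  "vertex_labels p l f = map (\<lambda>i. l (f (\<lambda>j. if j = i then 1 else 0))) [0..<Suc p]"

lemma length_vertex_labels [simp]: "length (vertex_labels p l f) = Suc p"
  by (simp add: vertex_labels_def)

lemma vertex_labels_singular_face:
  assumes "k \<le> Suc p"
  shows "vertex_labels p l (singular_face (Suc p) k f) = delete_nth k (vertex_labels (Suc p) l f)"
proof (rule nth_equalityI)
  fix i assume "i < length (vertex_labels p l (singular_face (Suc p) k f))"
  then have i: "i \<le> p" by simp
  have face: "simplical_face k (\<lambda>j. if j = i then 1 else 0 :: real) =
      (\<lambda>j. if j = (if i < k then i else Suc i) then 1 else 0)"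
    by (auto simp: simplical_face_def fun_eq_iff)
  have "vertex_labels p l (singular_face (Suc p) k f) ! i =
      l (f (\<lambda>j. if j = (if i < k then i else Suc i) then 1 else 0))"
    using i by (simp add: vertex_labels_def singular_face_def face del: upt_Suc)
  also have "\<dots> = delete_nth k (vertex_labels (Suc p) l f) ! i"
    using i assms
    by (simp add: delete_nth_def nth_append vertex_labels_def min_def del: upt_Suc)
  finally show "vertex_labels p l (singular_face (Suc p) k f) ! i =
      delete_nth k (vertex_labels (Suc p) l f) ! i" .
qed (use assms in \<open>simp add: delete_nth_def\<close>)

lemma vertex_labels_simplex_map:
  "vertex_labels p l (simplex_map p T f) = vertex_labels p (l \<circ> T) f"
  by (simp add: vertex_labels_def simplex_map_def)

text \<open>Linear extension of \<open>fan_cochain\<close> to chains. Since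
  \<open>frag_extend\<close> takes values in formal sums, integers are represented as multiples of
  the one generator \<open>()\<close> and read off by \<open>lookup\<close>.\<close>

definition fan_count :: "nat \<Rightarrow> ('a \<Rightarrow> nat) \<Rightarrow> 'a chain \<Rightarrow> int" where
  "fan_count p l c =
    Poly_Mapping.lookup (frag_extend (\<lambda>f. frag_cmul (fan_cochain (vertex_labels p l f)) (frag_of ())) c) ()"

lemma fan_count_0 [simp]: "fan_count p l 0 = 0"
  and fan_count_of [simp]: "fan_count p l (frag_of f) = fan_cochain (vertex_labels p l f)"
  and fan_count_add: "fan_count p l (a + b) = fan_count p l a + fan_count p l b"
  and fan_count_diff: "fan_count p l (a - b) = fan_count p l a - fan_count p l b"
  and fan_count_cmul: "fan_count p l (frag_cmul m a) = m * fan_count p l a"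
  by (simp_all add: fan_count_def frag_extend_add frag_extend_diff frag_extend_cmul lookup_add lookup_minus)

lemma fan_count_sum: "fan_count p l (sum g I) = (\<Sum>i\<in>I. fan_count p l (g i))"
  by (induction I rule: infinite_finite_induct) (simp_all add: fan_count_add)

text \<open>What a sufficiently small simplex inherits from an odd map without zeros.\<close>

definition good_simplex :: "nat \<Rightarrow> ('a \<Rightarrow> 'a) \<Rightarrow> ('a \<Rightarrow> nat) \<Rightarrow> ((nat \<Rightarrow> real) \<Rightarrow> 'a) \<Rightarrow> bool" where
  "good_simplex p T l f \<longleftrightarrow> opposite_free (set (vertex_labels p l f)) \<and>
     vertex_labels p (l \<circ> T) f = map opp_label (vertex_labels p l f)"

text \<open>By linearity one simplex suffices. The signs \<open>(-1) ^ k\<close> of its faces are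
  invisible modulo 2, which reduces the claim to \<open>fan_boundary\<close>.\<close>

lemma fan_count_boundary:
  assumes "Poly_Mapping.keys c \<subseteq> {f. good_simplex (Suc p) T l f}"
  shows "even (fan_count p l (chain_boundary (Suc p) c) + fan_count (Suc p) l c
               + fan_count (Suc p) l (chain_map (Suc p) T c))"
  using assms
proof (induction c rule: frag_induction)
  case (one f)
  let ?L = "vertex_labels (Suc p) l f"
  have sgn: "even ((\<Sum>k\<in>I. (-1) ^ k * g k) + sum g I)" for I and g :: "nat \<Rightarrow> int"
    by (induction I rule: infinite_finite_induct) (auto simp: minus_one_power_iff)
  have "fan_count p l (chain_boundary (Suc p) (frag_of f)) =
      (\<Sum>k\<le>Suc p. (-1) ^ k * fan_cochain (delete_nth k ?L))"
    by (simp add: chain_boundary_of fan_count_sum fan_count_cmul vertex_labels_singular_face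
        del: sum.atMost_Suc)
  moreover have "{..Suc p} = {..<length ?L}"
    by auto
  moreover have "even ((\<Sum>k<length ?L. fan_cochain (delete_nth k ?L)) + fan_cochain ?L + fan_cochain (map opp_label ?L))"
    using one by (intro fan_boundary) (simp add: good_simplex_def)
  ultimately show ?case
    using sgn[of "\<lambda>k. fan_cochain (delete_nth k ?L)" "{..<length ?L}"] one
    by (simp add: vertex_labels_simplex_map good_simplex_def)
next
  case (diff a b)
  then show ?case
    by (simp add: chain_boundary_diff chain_map_diff fan_count_diff) presburger
qed auto

lemma fan_count_eq_0:
  assumes "Poly_Mapping.keys c \<subseteq> {f. good_simplex p T l f \<and> set (vertex_labels p l f) \<subseteq> {..<2 * p}}"
  shows "fan_count p l c = 0"
  using assms
proof (induction c rule: frag_induction)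
  case (one f)
  then show ?case
    by (auto simp: good_simplex_def intro!: fan_eq_0[where n = p])
qed (auto simp: fan_count_diff)

text \<open>\<open>q i\<close> counts alternating simplices in \<open>d i\<close> and in its
  antipodal image. Its parity is the same for all \<open>i \<le> n\<close>, because
  \<open>fan_count_boundary\<close> and \<open>bd\<close> both evaluate the count on the boundary of
  \<open>d (Suc i)\<close>. It is odd at 0 and zero at \<open>n\<close>.\<close>

lemma no_good_equivariant_chain:
  fixes d :: "nat \<Rightarrow> 'a chain" and l :: "'a \<Rightarrow> nat"
  assumes good: "\<And>i. i \<le> n \<Longrightarrow> Poly_Mapping.keys (d i) \<subseteq> {f. good_simplex i T l f}"
    and range: "\<And>i f. f \<in> Poly_Mapping.keys (d n) \<Longrightarrow> set (vertex_labels n l f) \<subseteq> {..<2 * n}"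
    and bd: "\<And>i. i < n \<Longrightarrow> chain_boundary (Suc i) (d (Suc i)) =
               d i + frag_cmul ((-1) ^ Suc i) (chain_map i T (d i))"
    and d0: "d 0 = frag_of f0"
  shows False
proof -
  define q where "q i = fan_count i l (d i) + fan_count i l (chain_map i T (d i))" for i
  have step: "even (q i + q (Suc i))" if "i < n" for i
  proof -
    have "even (fan_count i l (chain_boundary (Suc i) (d (Suc i))) + q (Suc i))"
      using fan_count_boundary[OF good[of "Suc i"]] that by (simp add: q_def add.assoc)
    moreover have "even (fan_count i l (chain_boundary (Suc i) (d (Suc i))) + q i)"
      using bd[OF that]
      by (cases "even i") (simp_all add: q_def fan_count_add fan_count_diff fan_count_cmul)
    ultimately show ?thesis by presburger
  qed
  have "odd (q i)" if "i \<le> n" for i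
    using that
  proof (induction i)
    case 0
    \<comment> \<open>A point and its antipode carry labels of opposite sign, so exactly one of the
      two is counted.\<close>
    have "vertex_labels 0 (l \<circ> T) f0 = map opp_label (vertex_labels 0 l f0)"
      using good[of 0] by (simp add: d0 good_simplex_def)
    then show ?case
      by (auto simp: q_def d0 simplex_map_def fan_cochain_def vertex_labels_def)
  next
    case (Suc i)
    then show ?case using step[of i] by simp
  qed
  moreover have "fan_count n l (d n) = 0"
    using good range by (intro fan_count_eq_0) auto
  moreover have "fan_count n l (chain_map n T (d n)) = 0"
  proof -
    have "fan_count n l (chain_map n T c) = 0"
      if "Poly_Mapping.keys c \<subseteq> {f. good_simplex n T l f \<and> set (vertex_labels n l f) \<subseteq> {..<2 * n}}" for c
      using that
    proof (induction c rule: frag_induction)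
      case (one f)
      \<comment> \<open>\<open>opp_label\<close> exchanges \<open>2 * a\<close> and
        \<open>2 * a + 1\<close>, so antipodal labels stay below \<open>2 * n\<close> and the
        pigeonhole applies to them too.\<close>
      have "opp_label a < 2 * n" if "a < 2 * n" for a
        using that by (auto simp: opp_label_def elim!: evenE)
      then have "fan_cochain (map opp_label (vertex_labels n l f)) = 0"
        using one by (intro fan_eq_0[where n = n]) (auto simp: good_simplex_def)
      then show ?case
        using one by (simp add: vertex_labels_simplex_map good_simplex_def)
    qed (auto simp: fan_count_diff chain_map_diff)
    then show ?thesis using good range by blast
  qed
  ultimately show False
    unfolding q_def by fastforce
qed

section \<open>Equivariant chains on the sphere from vanishing homology\<close>

lemma cycle_is_boundary:
  assumes "trivial_group (homology_group (int p) X)" "singular_relcycle p X {} z"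
  obtains d where "singular_chain (Suc p) X d" "chain_boundary (Suc p) d = z"
proof -
  have "homologous_rel_set p X {} z \<in> carrier (homology_group (int p) X)"
    using assms(2) by (auto simp: carrier_relative_homology_group)
  then have "singular_relboundary p X {} z"
    using assms(1) by (simp add: trivial_group_def flip: homologous_rel_set_eq_relboundary)
  then show ?thesis
    using that by (auto simp: singular_boundary)
qed

text \<open>In degree 0 it is the reduced homology that vanishes. It is the kernel of the map
  induced by collapsing to one point, where both simplices have the same image.\<close>

lemma points_homologous_nsphere:
  assumes "n > 0" "singular_simplex 0 (nsphere n) f" "singular_simplex 0 (nsphere n) g"
  obtains d where "singular_chain 1 (nsphere n) d" "chain_boundary 1 d = frag_of f - frag_of g"
proof -
  let ?X = "nsphere n" and ?P = "discrete_topology {()}"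
  let ?z = "frag_of f - frag_of g"
  have cyc: "singular_relcycle 0 ?X {} ?z"
    using assms by (simp add: singular_cycle singular_chain_diff singular_chain_of chain_boundary_def)
  have cont: "continuous_map ?X ?P (\<lambda>x. ())"
    by simp
  have "simplex_map 0 (\<lambda>x. ()) f = simplex_map 0 (\<lambda>x. ()) g"
    by (auto simp: simplex_map_def)
  then have "chain_map 0 (\<lambda>x. ()) ?z = 0"
    by (simp add: chain_map_diff)
  then have "hom_induced 0 ?X {} ?P {} (\<lambda>x. ()) (homologous_rel_set 0 ?X {} ?z) =
      \<one>\<^bsub>homology_group (int 0) ?P\<^esub>"
    using hom_induced_chain_map[OF cont _ cyc, of "{}"] 
    by (simp only: one_relative_homology_group) (simp add: homologous_rel_set_eq_relboundary)
  then have "homologous_rel_set 0 ?X {} ?z \<in> carrier (reduced_homology_group 0 ?X)"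
    using cyc by (auto simp: carrier_reduced_homology_group kernel_def carrier_relative_homology_group_0)
  moreover have "trivial_group (reduced_homology_group 0 ?X)"
    using assms(1) by (intro reduced_homology_group_nsphere) auto
  ultimately have "homologous_rel_set 0 ?X {} ?z = \<one>\<^bsub>homology_group (int 0) ?X\<^esub>"
    by (simp add: trivial_group_def one_reduced_homology_group)
  then have "singular_relboundary 0 ?X {} ?z"
    by (simp only: one_relative_homology_group homologous_rel_set_eq_relboundary)
  then show ?thesis
    using that by (auto simp: singular_boundary)
qed

lemma continuous_map_nsphere_antipode: "continuous_map (nsphere n) (nsphere n) (\<lambda>x i. - x i)"
  unfolding nsphere continuous_map_in_subtopology
  by (auto intro!: continuous_map_from_subtopology continuous_intros simp: continuous_map_componentwise_UNIV)

lemma chain_map_involution: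
  assumes "singular_chain p X c" "\<And>x. T (T x) = x"
  shows "chain_map p T (chain_map p T c) = c"
proof -
  have "chain_map p (T \<circ> T) c = c"
    using assms by (intro chain_map_id_gen) auto
  then show ?thesis
    by (simp add: chain_map_compose)
qed

text \<open>Each new chain fills the cycle \<open>?z\<close> built from the previous one: homology
  vanishes in degrees strictly between 0 and \<open>n\<close>, and degree 0 is
  \<open>points_homologous_nsphere\<close>.\<close>

lemma nsphere_equivariant_chains:
  fixes n :: nat
  defines "T \<equiv> (\<lambda>x (i::nat). - x i :: real)"
  assumes "n > 0" and f: "singular_simplex 0 (nsphere n) f"
  shows "m \<le> n \<Longrightarrow> \<exists>c. c 0 = frag_of f \<and> (\<forall>i\<le>m. singular_chain i (nsphere n) (c i)) \<and>
     (\<forall>i<m. chain_boundary (Suc i) (c (Suc i)) = c i + frag_cmul ((-1) ^ Suc i) (chain_map i T (c i)))"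
proof (induction m)
  case 0
  show ?case
    using f by (intro exI[of _ "\<lambda>_. frag_of f"]) (simp add: singular_chain_of)
next
  case (Suc m)
  let ?X = "nsphere n"
  have T: "continuous_map ?X ?X T"
    unfolding T_def by (rule continuous_map_nsphere_antipode)
  obtain c where c0: "c 0 = frag_of f" and c: "\<And>i. i \<le> m \<Longrightarrow> singular_chain i ?X (c i)"
    and bd: "\<And>i. i < m \<Longrightarrow> chain_boundary (Suc i) (c (Suc i)) =
                c i + frag_cmul ((-1) ^ Suc i) (chain_map i T (c i))"
    using Suc by auto
  let ?z = "c m + frag_cmul ((-1) ^ Suc m) (chain_map m T (c m))"
  have chain_z: "singular_chain m ?X ?z"
    using c T by (intro singular_chain_add singular_chain_cmul singular_chain_chain_map) auto
  have "\<exists>d. singular_chain (Suc m) ?X d \<and> chain_boundary (Suc m) d = ?z"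
  proof (cases m)
    case 0
    have "singular_simplex 0 ?X (simplex_map 0 T f)"
      using f T by (rule singular_simplex_simplex_map)
    from points_homologous_nsphere[OF \<open>n > 0\<close> f this]
    show ?thesis by (auto simp: 0 c0)
  next
    case (Suc k)
    \<comment> \<open>The boundary of \<open>c m\<close> is \<open>c k\<close> plus or minus its
      antipode. Applying the involution \<open>T\<close> with the next sign gives the same two terms
      negated.\<close>
    have "chain_boundary m ?z = 0"
    proof -
      have TT: "chain_map k T (chain_map k T (c k)) = c k"
        using c[of k] Suc by (intro chain_map_involution) (auto simp: T_def)
      have "chain_boundary m ?z = chain_boundary m (c m) +
          frag_cmul ((-1) ^ Suc m) (chain_map k T (chain_boundary m (c m)))"
        using chain_boundary_chain_map[OF c[of m], of T] Suc
        by (simp add: chain_boundary_add chain_boundary_cmul)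
      then show ?thesis
        using bd[of k] Suc
        by (cases "even k") (simp_all add: chain_map_add chain_map_diff TT)
    qed
    then have "singular_relcycle m ?X {} ?z"
      using chain_z by (simp add: singular_cycle)
    moreover have "trivial_group (homology_group (int m) ?X)"
      using reduced_homology_group_nsphere(2)[of "int m" n] un_reduced_homology_group[of "int m" ?X]
        Suc Suc.prems by simp
    ultimately show ?thesis
      by (metis cycle_is_boundary)
  qed
  then obtain d where d: "singular_chain (Suc m) ?X d" "chain_boundary (Suc m) d = ?z"
    by blast
  show ?case
    using c0 c bd d
    by (intro exI[of _ "c(Suc m := d)"]) (auto simp: le_Suc_eq less_Suc_eq)
qed

section \<open>Labels from the coordinate of largest modulus\<close>

definition max_abs :: "nat \<Rightarrow> (nat \<Rightarrow> real) \<Rightarrow> real" where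
  "max_abs n v = Max ((\<lambda>i. \<bar>v i\<bar>) ` {..<n})"

definition max_index :: "nat \<Rightarrow> (nat \<Rightarrow> real) \<Rightarrow> nat" where
  "max_index n v = (LEAST i. i < n \<and> \<bar>v i\<bar> = max_abs n v)"

text \<open>The position of the largest coordinate, together with its sign, in the encoding of
  labels. Ties go to the least index, which is the same for \<open>v\<close> and \<open>- v\<close>,
  so the label is odd.\<close>

definition orthant_label :: "nat \<Rightarrow> (nat \<Rightarrow> real) \<Rightarrow> nat" where
  "orthant_label n v = 2 * max_index n v + of_bool (v (max_index n v) < 0)"

lemma abs_le_max_abs: "i < n \<Longrightarrow> \<bar>v i\<bar> \<le> max_abs n v"
  by (simp add: max_abs_def)

lemma max_index:
  assumes "n > 0"
  shows "max_index n v < n" "\<bar>v (max_index n v)\<bar> = max_abs n v"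
proof -
  have "max_abs n v \<in> (\<lambda>i. \<bar>v i\<bar>) ` {..<n}"
    using assms unfolding max_abs_def by (intro Max_in) auto
  then have "\<exists>i. i < n \<and> \<bar>v i\<bar> = max_abs n v"
    by force
  then show "max_index n v < n" "\<bar>v (max_index n v)\<bar> = max_abs n v"
    unfolding max_index_def by (metis (mono_tags, lifting) LeastI_ex)+
qed

lemma max_abs_pos: "i < n \<Longrightarrow> v i \<noteq> 0 \<Longrightarrow> max_abs n v > 0"
  using abs_le_max_abs[of i n v] by linarith

lemma orthant_label_less: "n > 0 \<Longrightarrow> orthant_label n v < 2 * n"
  using max_index(1)[of n v] by (auto simp: orthant_label_def)

lemma orthant_label_uminus:
  assumes "i < n" "v i \<noteq> 0"
  shows "orthant_label n (\<lambda>i. - v i) = opp_label (orthant_label n v)"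
proof -
  have "max_abs n (\<lambda>i. - v i) = max_abs n v"
    by (simp add: max_abs_def)
  then have "max_index n (\<lambda>i. - v i) = max_index n v"
    by (simp add: max_index_def)
  moreover have "v (max_index n v) \<noteq> 0"
    using max_index(2)[of n v] max_abs_pos[of i n v] assms by force
  ultimately show ?thesis
    by (auto simp: orthant_label_def opp_label_def)
qed

text \<open>With opposite labels, \<open>x\<close> and \<open>y\<close> would have their largest
  coordinates at a common index \<open>a\<close> and with opposite signs. Both exceed half of
  \<open>max_abs n z\<close> in modulus, so they would be too far apart for two points this close to
  \<open>z\<close>.\<close>

lemma orthant_label_near:
  assumes n: "n > 0"
    and x: "\<And>i. i < n \<Longrightarrow> \<bar>x i - z i\<bar> < max_abs n z / 2"
    and y: "\<And>i. i < n \<Longrightarrow> \<bar>y i - z i\<bar> < max_abs n z / 2"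
  shows "orthant_label n x \<noteq> opp_label (orthant_label n y)"
proof
  assume eq: "orthant_label n x = opp_label (orthant_label n y)"
  define a where "a = max_index n y"
  have a: "max_index n x = a"
    using arg_cong[OF eq, of "\<lambda>k. k div 2"] by (simp add: orthant_label_def a_def)
  have sgn: "x a < 0 \<longleftrightarrow> \<not> y a < 0"
    using arg_cong[OF eq, of even] by (simp add: orthant_label_def a of_bool_def split: if_splits flip: a_def)
  have big: "\<bar>v a\<bar> > max_abs n z / 2"
    if v: "\<And>i. i < n \<Longrightarrow> \<bar>v i - z i\<bar> < max_abs n z / 2" and "max_index n v = a" for v
  proof -
    have "\<bar>v (max_index n z)\<bar> > max_abs n z / 2"
      using v[of "max_index n z"] max_index[OF n, of z] by linarith
    also have "\<bar>v (max_index n z)\<bar> \<le> \<bar>v a\<bar>"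
      using abs_le_max_abs[of "max_index n z" n v] max_index[OF n, of z] max_index[OF n, of v] that(2)
      by simp
    finally show ?thesis .
  qed
  have "a < n"
    using max_index[OF n] a_def by simp
  then show False
    using big[OF x a] big[OF y] x[of a] y[of a] sgn by (auto simp: a_def[symmetric] abs_if split: if_splits)
qed

section \<open>Subdivided equivariant chains and the Borsuk-Ulam theorem\<close>

lemma singular_subdivision_power:
  assumes "singular_chain p X c"
  shows "singular_chain p X ((singular_subdivision p ^^ m) c)"
  using assms by (induction m) (auto simp: singular_chain_singular_subdivision)

lemma chain_map_singular_subdivision_power:
  assumes "singular_chain p X c"
  shows "chain_map p g ((singular_subdivision p ^^ m) c) = (singular_subdivision p ^^ m) (chain_map p g c)"
  using assms
  by (induction m)
    (auto simp flip: naturality_singular_subdivision[OF singular_subdivision_power[OF assms]])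

lemma chain_boundary_singular_subdivision_power:
  assumes "singular_chain (Suc p) X c"
  shows "chain_boundary (Suc p) ((singular_subdivision (Suc p) ^^ m) c) =
         (singular_subdivision p ^^ m) (chain_boundary (Suc p) c)"
  by (induction m)
    (auto simp: chain_boundary_singular_subdivision[OF singular_subdivision_power[OF assms]])

lemma singular_subdivision_power_add_sign:
  "(singular_subdivision p ^^ m) (a + frag_cmul ((-1) ^ k) b) =
   (singular_subdivision p ^^ m) a + frag_cmul ((-1) ^ k) ((singular_subdivision p ^^ m) b)"
proof -
  have minus: "singular_subdivision p (- a) = - singular_subdivision p a" for a :: "'a chain"
    using singular_subdivision_diff[of p 0 a] by simp
  show ?thesis
    by (induction m) (cases "even k"; simp add: singular_subdivision_add singular_subdivision_diff minus)+
qed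

theorem Borsuk_Ulam_nsphere:
  assumes cont: "continuous_map (nsphere n) (powertop_real UNIV) g"
    and odd: "\<And>x. x \<in> topspace (nsphere n) \<Longrightarrow> g (\<lambda>i. - x i) = (\<lambda>i. - g x i)"
    and nz: "\<And>x. x \<in> topspace (nsphere n) \<Longrightarrow> \<exists>i<n. g x i \<noteq> 0"
  shows False
proof -
  let ?X = "nsphere n"
  define T where "T = (\<lambda>x (i::nat). - x i :: real)"
  define l where "l x = orthant_label n (g x)" for x
  \<comment> \<open>Half of the largest coordinate is the radius required by
    \<open>orthant_label_near\<close>.\<close>
  define U where "U z = {x \<in> topspace ?X. \<forall>i<n. \<bar>g x i - g z i\<bar> < max_abs n (g z) / 2}" for z
  have n: "n > 0"
    using nz[OF in_topspace_nsphere] by auto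
  have openU: "openin ?X (U z)" for z
  proof -
    have "openin ?X {x \<in> topspace ?X. \<bar>g x i - g z i\<bar> \<in> {..<max_abs n (g z) / 2}}" for i
    proof (rule openin_continuous_map_preimage)
      have "continuous_map ?X euclideanreal (\<lambda>x. g x i)"
        using cont by (simp add: continuous_map_componentwise_UNIV)
      then show "continuous_map ?X euclideanreal (\<lambda>x. \<bar>g x i - g z i\<bar>)"
        by (intro continuous_intros)
    qed simp
    moreover have "U z = (\<Inter>i<n. {x \<in> topspace ?X. \<bar>g x i - g z i\<bar> \<in> {..<max_abs n (g z) / 2}})"
      using n by (auto simp: U_def)
    ultimately show ?thesis
      using n by (auto intro!: openin_Inter)
  qed
  have cover: "topspace ?X \<subseteq> \<Union> (U ` topspace ?X)"
  proof
    fix x assume x: "x \<in> topspace ?X"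
    then have "x \<in> U x"
      using nz[OF x] max_abs_pos by (auto simp: U_def)
    then show "x \<in> \<Union> (U ` topspace ?X)"
      using x by blast
  qed
  \<comment> \<open>The base point is \<open>(1, 0, 0, ...)\<close>; \<open>restrict\<close> makes
    the constant map extensional, as singular simplices are.\<close>
  define f0 where "f0 = restrict (\<lambda>_::nat \<Rightarrow> real. (\<lambda>n::nat. if n = 0 then 1 else 0 :: real)) (standard_simplex 0)"
  have f0: "singular_simplex 0 ?X f0"
    unfolding f0_def singular_simplex_def using in_topspace_nsphere[of n] by auto
  obtain c where c0: "c 0 = frag_of f0" and c: "\<And>i. i \<le> n \<Longrightarrow> singular_chain i ?X (c i)"
    and bd: "\<And>i. i < n \<Longrightarrow> chain_boundary (Suc i) (c (Suc i)) =
               c i + frag_cmul ((-1) ^ Suc i) (chain_map i T (c i))"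
    using nsphere_equivariant_chains[OF n f0 order_refl] unfolding T_def by auto
  have "\<exists>N. \<forall>m f. N \<le> m \<longrightarrow> f \<in> Poly_Mapping.keys ((singular_subdivision i ^^ m) (c i)) \<longrightarrow>
          (\<exists>z\<in>topspace ?X. f \<in> standard_simplex i \<rightarrow> U z)" if "i \<le> n" for i
    by (rule sufficient_iterated_singular_subdivision_exists[of "U ` topspace ?X" ?X i "c i"])
      (use openU cover c[OF that] in auto)
  then obtain N where N: "\<And>i m f. i \<le> n \<Longrightarrow> N i \<le> m \<Longrightarrow>
      f \<in> Poly_Mapping.keys ((singular_subdivision i ^^ m) (c i)) \<Longrightarrow>
      \<exists>z\<in>topspace ?X. f \<in> standard_simplex i \<rightarrow> U z"
    by metis
  \<comment> \<open>The same number of subdivisions serves all degrees, so the boundary relations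
    between consecutive chains survive.\<close>
  define M where "M = Max (N ` {..n})"
  have M: "N i \<le> M" if "i \<le> n" for i
    using that by (simp add: M_def)
  define d where "d i = (singular_subdivision i ^^ M) (c i)" for i
  have good: "good_simplex i T l f" if i: "i \<le> n" and f: "f \<in> Poly_Mapping.keys (d i)" for i f
  proof -
    obtain z where z: "z \<in> topspace ?X" and fz: "f \<in> standard_simplex i \<rightarrow> U z"
      using N[OF i M[OF i]] f by (auto simp: d_def)
    have vert: "f (\<lambda>j. if j = k then 1 else 0) \<in> U z" if "k \<le> i" for k
      using fz that by (auto simp: Pi_iff)
    have near: "l x \<noteq> opp_label (l y)" if "x \<in> U z" "y \<in> U z" for x y
      using that unfolding l_def U_def by (intro orthant_label_near[OF n, of _ "g z"]) auto
    have "set (vertex_labels i l f) \<subseteq> l ` U z"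
      using vert by (auto simp: vertex_labels_def less_Suc_eq_le simp del: upt_Suc)
    then have "opposite_free (set (vertex_labels i l f))"
      using near unfolding opposite_free_def by (metis imageE subsetD)
    moreover have "l (T x) = opp_label (l x)" if "x \<in> U z" for x
      using nz[of x] odd[of x] that by (auto simp: l_def T_def U_def orthant_label_uminus)
    ultimately show ?thesis
      using vert by (auto simp: good_simplex_def vertex_labels_def simp del: upt_Suc)
  qed
  show False
  proof (rule no_good_equivariant_chain[where d = d and T = T and l = l and n = n])
    show "Poly_Mapping.keys (d i) \<subseteq> {f. good_simplex i T l f}" if "i \<le> n" for i
      using good[OF that] by blast
    show "set (vertex_labels n l f) \<subseteq> {..<2 * n}" for f
      using n by (auto simp: vertex_labels_def l_def orthant_label_less)
    show "chain_boundary (Suc i) (d (Suc i)) = d i + frag_cmul ((-1) ^ Suc i) (chain_map i T (d i))"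
      if "i < n" for i
      using that c bd unfolding d_def
      by (simp add: chain_boundary_singular_subdivision_power[of _ ?X] chain_map_singular_subdivision_power[of _ ?X]
          singular_subdivision_power_add_sign del: power_Suc)
    \<comment> \<open>Subdivision fixes 0-chains, so the bottom chain remains a single
      point.\<close>
    have "(singular_subdivision 0 ^^ m) (c 0) = c 0" for m
      using c[of 0] by (induction m) (auto simp: singular_subdivision_zero)
    then show "d 0 = frag_of f0"
      by (simp add: d_def c0)
  qed
qed

subsection \<open>Frustrated energy and existence of the limit\<close>

definition signed_powr :: "real \<Rightarrow> real \<Rightarrow> real" where
  "signed_powr r x = sgn x * \<bar>x\<bar> powr r"

lemma signed_powr_uminus [simp]: "signed_powr r (- x) = - signed_powr r x"
  and signed_powr_0 [simp]: "signed_powr r 0 = 0"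
  and signed_powr_1 [simp]: "signed_powr 1 x = x"
  and sgn_signed_powr [simp]: "sgn (signed_powr r x) = sgn x"
  and abs_signed_powr: "\<bar>signed_powr r x\<bar> = \<bar>x\<bar> powr r"
  by (auto simp: signed_powr_def sgn_mult abs_mult sgn_if)

lemma signed_powr_signed_powr: "signed_powr s (signed_powr r x) = signed_powr (r * s) x"
  by (cases "x = 0") (auto simp: signed_powr_def sgn_mult abs_mult powr_powr sgn_if)

lemma continuous_on_signed_powr [continuous_intros]:
  assumes "continuous_on S f" "r > 0"
  shows "continuous_on S (\<lambda>x. signed_powr r (f x))"
proof -
  \<comment> \<open>Powers of the positive and negative parts avoid the jump of \<open>sgn\<close>
    at 0.\<close>
  have "signed_powr r y = max y 0 powr r - max (- y) 0 powr r" for y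
    using assms(2) by (auto simp: signed_powr_def max_def sgn_if)
  then show ?thesis
    using assms
    by (auto intro!: continuous_on_diff continuous_on_powr' continuous_on_max continuous_on_const
        continuous_on_minus)
qed

lemma powr_le_sum_powr:
  fixes a b x p :: real
  assumes "0 \<le> x" "x \<le> a \<or> x \<le> b" "p \<ge> 0"
  shows "x powr p \<le> a powr p + b powr p"
  using assms powr_mono2[of p x a] powr_mono2[of p x b] powr_ge_zero[of a p] powr_ge_zero[of b p]
  by linarith

text \<open>Convexity of the power \<open>r = q / p \<ge> 1\<close> at \<open>a powr (p / q)\<close>
  and \<open>b powr (p / q)\<close>, followed by raising to the power \<open>p\<close>.\<close>

lemma mean_powr_antimono:
  fixes a b p q :: real
  assumes "0 < p" "p \<le> q" "0 < a" "0 < b"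
  shows "((a powr (p / q) + b powr (p / q)) / 2) powr q \<le> ((a + b) / 2) powr p"
proof -
  define r where "r = q / p"
  have r: "r \<ge> 1" using assms by (simp add: r_def)
  let ?x = "a powr (p / q)" and ?y = "b powr (p / q)"
  have xy: "?x powr r = a" "?y powr r = b"
    using assms by (simp_all add: powr_powr r_def)
  have "((1 - 1/2) *\<^sub>R ?x + (1/2) *\<^sub>R ?y) powr r \<le> (1 - 1/2) * ?x powr r + (1/2) * ?y powr r"
    using assms by (intro convex_onD[OF powr_convex[OF r]]) auto
  then have "((?x + ?y) / 2) powr r \<le> (a + b) / 2"
    by (simp add: xy field_simps)
  then have "(((?x + ?y) / 2) powr r) powr p \<le> ((a + b) / 2) powr p"
    using assms by (intro powr_mono2) auto
  then show ?thesis
    using assms by (simp add: powr_powr r_def)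
qed

section \<open>Monotonicity of the genus and comparison of min-max values\<close>

lemma genus_ge_mono: "genus_ge B l \<Longrightarrow> k \<le> l \<Longrightarrow> genus_ge B k"
  unfolding genus_ge_def by (meson order_less_le_trans)

lemma genus_ge_nonempty: "genus_ge B k \<Longrightarrow> k > 0 \<Longrightarrow> B \<noteq> {}"
  unfolding genus_ge_def by auto

text \<open>An odd map from the image to a lower dimension would give one on \<open>B\<close> by
  composition with \<open>h\<close>.\<close>

lemma genus_ge_image:
  assumes "genus_ge B k" "continuous_on B h" "\<And>x. x \<in> B \<Longrightarrow> h (\<lambda>i. - x i) = (\<lambda>i. - h x i)"
  shows "genus_ge (h ` B) k"
  unfolding genus_ge_def
proof clarify
  fix j and g :: "('b \<Rightarrow> real) \<Rightarrow> nat \<Rightarrow> real"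
  assume "j < k" "continuous_on (h ` B) g"
    and "\<forall>x\<in>h ` B. g (\<lambda>i. - x i) = (\<lambda>i. - g x i)"
    and "\<forall>x\<in>h ` B. g x \<in> Rspace j - {\<lambda>_. 0}"
  then have "\<exists>j<k. \<exists>g :: ('a \<Rightarrow> real) \<Rightarrow> (nat \<Rightarrow> real). continuous_on B g \<and>
      (\<forall>x\<in>B. g (\<lambda>i. - x i) = (\<lambda>i. - g x i)) \<and> (\<forall>x\<in>B. g x \<in> Rspace j - {\<lambda>_. 0})"
    using assms by (intro exI[of _ j] conjI exI[of _ "g \<circ> h"]) (auto intro: continuous_on_compose2[of "h ` B" g B h])
  then show False
    using assms(1) by (simp add: genus_ge_def)
qed

text \<open>Every set of \<open>F2\<close> is matched by a set of \<open>F1\<close> on which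
  \<open>r\<close> is controlled pointwise. The bounds and nonemptiness make the real
  \<open>INF\<close> and \<open>SUP\<close> genuine infima and suprema.\<close>

lemma minmax_le:
  fixes r e :: "'a \<Rightarrow> real" and a c :: real
  assumes "F2 \<noteq> {}" "\<And>B. B \<in> F1 \<Longrightarrow> B \<noteq> {}" "\<And>B. B \<in> F2 \<Longrightarrow> B \<noteq> {}"
    and bounds: "\<And>B f. B \<in> F1 \<Longrightarrow> f \<in> B \<Longrightarrow> \<bar>r f\<bar> \<le> K" "\<And>B f. B \<in> F2 \<Longrightarrow> f \<in> B \<Longrightarrow> e f \<le> K'"
    and "a > 0"
    and le: "\<And>B. B \<in> F2 \<Longrightarrow> \<exists>B'\<in>F1. \<forall>f\<in>B'. \<exists>f'\<in>B. r f \<le> a * e f' + c"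
  shows "(INF B\<in>F1. SUP f\<in>B. r f) \<le> a * (INF B\<in>F2. SUP f\<in>B. e f) + c"
proof -
  have "((INF B\<in>F1. SUP f\<in>B. r f) - c) / a \<le> (SUP f\<in>B. e f)" if B: "B \<in> F2" for B
  proof -
    obtain B' where B': "B' \<in> F1" "\<And>f. f \<in> B' \<Longrightarrow> \<exists>f'\<in>B. r f \<le> a * e f' + c"
      using le[OF B] by blast
    have bdd: "bdd_above (e ` B)"
      using bounds(2)[OF B] by (rule bdd_aboveI2)
    have "bdd_below ((\<lambda>B. SUP f\<in>B. r f) ` F1)"
    proof (rule bdd_belowI2[where m = "- K"])
      fix D assume D: "D \<in> F1"
      then obtain f where f: "f \<in> D" using assms(2) by blast
      have "- K \<le> r f"
        using bounds(1)[OF D f] by linarith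
      also have "\<dots> \<le> (SUP f\<in>D. r f)"
        using bounds(1)[OF D] f by (intro cSUP_upper bdd_aboveI2[where M = K]) (auto simp: abs_le_iff)
      finally show "- K \<le> (SUP f\<in>D. r f)" .
    qed
    then have "(INF B\<in>F1. SUP f\<in>B. r f) \<le> (SUP f\<in>B'. r f)"
      using B'(1) by (intro cINF_lower)
    also have "\<dots> \<le> a * (SUP f\<in>B. e f) + c"
    proof (rule cSUP_least)
      fix f assume "f \<in> B'"
      then obtain f' where f': "f' \<in> B" "r f \<le> a * e f' + c"
        using B'(2) by blast
      have "e f' \<le> (SUP f\<in>B. e f)"
        using bdd f'(1) by (intro cSUP_upper)
      then show "r f \<le> a * (SUP f\<in>B. e f) + c"
        using f'(2) \<open>a > 0\<close> by (smt (verit) mult_left_mono)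
    qed (use assms(2) B'(1) in blast)
    finally show ?thesis
      using \<open>a > 0\<close> by (simp add: field_simps)
  qed
  then have "((INF B\<in>F1. SUP f\<in>B. r f) - c) / a \<le> (INF B\<in>F2. SUP f\<in>B. e f)"
    using assms(1) by (intro cINF_greatest)
  then show ?thesis
    using \<open>a > 0\<close> by (simp add: field_simps)
qed

section \<open>Frustrated energy compared with the Rayleigh quotient\<close>

definition frustrated_energy ::
  "'a set \<Rightarrow> ('a \<Rightarrow> 'a \<Rightarrow> bool) \<Rightarrow> ('a \<Rightarrow> 'a \<Rightarrow> real) \<Rightarrow> ('a \<Rightarrow> 'a \<Rightarrow> real)
    \<Rightarrow> real \<Rightarrow> ('a \<Rightarrow> real) \<Rightarrow> real" where
  "frustrated_energy V A \<sigma> w p f = (1/2) * (\<Sum>i\<in>V. \<Sum>j\<in>V.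
     if A i j \<and> \<sigma> i j * f i * f j < 0 then w i j * ((\<bar>f i\<bar> + \<bar>f j\<bar>) / 2) powr p else 0)"

text \<open>A bound independent of \<open>p\<close>, from
  \<open>\<bar>f i\<bar> powr p \<le> 1 / \<mu> i\<close> on the unit sphere.\<close>

definition edge_bound ::
  "'a set \<Rightarrow> ('a \<Rightarrow> 'a \<Rightarrow> bool) \<Rightarrow> ('a \<Rightarrow> 'a \<Rightarrow> real) \<Rightarrow> ('a \<Rightarrow> real) \<Rightarrow> real" where
  "edge_bound V A w \<mu> = (1/2) * (\<Sum>i\<in>V. \<Sum>j\<in>V. if A i j then w i j * (1 / \<mu> i + 1 / \<mu> j) else 0)"

lemma psphere_powr_le:
  assumes "signed_graph V A \<sigma> w \<mu>" "f \<in> psphere V \<mu> p" "i \<in> V"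
  shows "\<bar>f i\<bar> powr p \<le> 1 / \<mu> i"
proof -
  have mu: "\<mu> j > 0" if "j \<in> V" for j
    using assms(1) that by (simp add: signed_graph_def)
  have "\<mu> i * \<bar>f i\<bar> powr p \<le> (\<Sum>i\<in>V. \<mu> i * \<bar>f i\<bar> powr p)"
    using assms mu by (intro member_le_sum) (auto simp: signed_graph_def less_imp_le)
  also have "\<dots> = 1"
    using assms(2) by (simp add: psphere_def pnorm_mu_def)
  finally show ?thesis
    using mu[OF assms(3)] by (simp add: field_simps)
qed

lemma frustrated_energy_nonneg:
  assumes "signed_graph V A \<sigma> w \<mu>"
  shows "0 \<le> frustrated_energy V A \<sigma> w p f"
  using assms unfolding frustrated_energy_def signed_graph_def
  by (auto intro!: sum_nonneg mult_nonneg_nonneg simp: less_imp_le)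

lemma frustrated_energy_le:
  assumes G: "signed_graph V A \<sigma> w \<mu>" and f: "f \<in> psphere V \<mu> p" and "p \<ge> 0"
  shows "frustrated_energy V A \<sigma> w p f \<le> edge_bound V A w \<mu>"
  unfolding frustrated_energy_def edge_bound_def
proof (intro mult_left_mono sum_mono)
  fix i j assume ij: "i \<in> V" "j \<in> V"
  have "((\<bar>f i\<bar> + \<bar>f j\<bar>) / 2) powr p \<le> \<bar>f i\<bar> powr p + \<bar>f j\<bar> powr p"
    using \<open>p \<ge> 0\<close> by (intro powr_le_sum_powr) auto
  also have "\<dots> \<le> 1 / \<mu> i + 1 / \<mu> j"
    using psphere_powr_le[OF G f] ij by (intro add_mono)
  finally have *: "((\<bar>f i\<bar> + \<bar>f j\<bar>) / 2) powr p \<le> 1 / \<mu> i + 1 / \<mu> j" .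
  moreover from this have "0 \<le> 1 / \<mu> i + 1 / \<mu> j"
    using powr_ge_zero order_trans by blast
  ultimately show "(if A i j \<and> \<sigma> i j * f i * f j < 0 then w i j * ((\<bar>f i\<bar> + \<bar>f j\<bar>) / 2) powr p else 0)
      \<le> (if A i j then w i j * (1 / \<mu> i + 1 / \<mu> j) else 0)"
    using G by (auto intro!: mult_left_mono mult_nonneg_nonneg simp: signed_graph_def less_imp_le)
qed auto

text \<open>On a frustrated edge \<open>\<bar>f i - \<sigma> i j * f j\<bar>\<close> is the sum of
  the two moduli, so the summands cancel exactly. On any other edge it is at most the larger
  modulus, and such terms are bounded independently of \<open>p\<close>, as is the
  potential.\<close>

lemma rayleigh_approx:
  assumes G: "signed_graph V A \<sigma> w \<mu>" and f: "f \<in> psphere V \<mu> p" and "p \<ge> 0"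
  shows "\<bar>rayleigh V A \<sigma> w \<mu> \<kappa> p f - 2 powr p * frustrated_energy V A \<sigma> w p f\<bar>
       \<le> edge_bound V A w \<mu> + (\<Sum>i\<in>V. \<bar>\<kappa> i\<bar> / \<mu> i)"
proof -
  define t where "t i j = (if A i j then w i j * \<bar>f i - \<sigma> i j * f j\<bar> powr p else 0)" for i j
  define s where "s i j = (if A i j \<and> \<sigma> i j * f i * f j < 0
                            then w i j * ((\<bar>f i\<bar> + \<bar>f j\<bar>) / 2) powr p else 0)" for i j
  have ts: "\<bar>t i j - 2 powr p * s i j\<bar> \<le> (if A i j then w i j * (1 / \<mu> i + 1 / \<mu> j) else 0)"
    if ij: "i \<in> V" "j \<in> V" for i j
  proof (cases "A i j")
    case True
    then have w: "w i j > 0" and \<sigma>: "\<sigma> i j = 1 \<or> \<sigma> i j = -1"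
      using G by (auto simp: signed_graph_def)
    have le: "\<bar>f i\<bar> powr p + \<bar>f j\<bar> powr p \<le> 1 / \<mu> i + 1 / \<mu> j"
      using psphere_powr_le[OF G f] ij by (intro add_mono)
    show ?thesis
    proof (cases "\<sigma> i j * f i * f j < 0")
      case opp: True
      then have "\<bar>f i - \<sigma> i j * f j\<bar> = \<bar>f i\<bar> + \<bar>f j\<bar>"
        using \<sigma> by (auto simp: mult_less_0_iff)
      then have "t i j = 2 powr p * s i j"
        using True opp by (simp add: t_def s_def powr_divide)
      moreover have "0 \<le> 1 / \<mu> i + 1 / \<mu> j"
        using le powr_ge_zero[of "\<bar>f i\<bar>" p] powr_ge_zero[of "\<bar>f j\<bar>" p] by linarith
      ultimately show ?thesis
        using True w by simp
    next
      case False
      then have "\<bar>f i - \<sigma> i j * f j\<bar> \<le> \<bar>f i\<bar> \<or> \<bar>f i - \<sigma> i j * f j\<bar> \<le> \<bar>f j\<bar>"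
        using \<sigma> by (auto simp: not_less zero_le_mult_iff mult_le_0_iff)
      then have "\<bar>f i - \<sigma> i j * f j\<bar> powr p \<le> \<bar>f i\<bar> powr p + \<bar>f j\<bar> powr p"
        using \<open>p \<ge> 0\<close> by (intro powr_le_sum_powr) auto
      then have "\<bar>f i - \<sigma> i j * f j\<bar> powr p \<le> 1 / \<mu> i + 1 / \<mu> j"
        using le by linarith
      then show ?thesis
        using True False w by (simp add: t_def s_def abs_mult)
    qed
  qed (simp add: t_def s_def)
  have \<kappa>: "\<bar>\<kappa> i * \<bar>f i\<bar> powr p\<bar> \<le> \<bar>\<kappa> i\<bar> / \<mu> i" if "i \<in> V" for i
    using mult_left_mono[OF psphere_powr_le[OF G f that], of "\<bar>\<kappa> i\<bar>"] by (simp add: abs_mult)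
  have "(\<Sum>i\<in>V. \<Sum>j\<in>V. t i j - 2 powr p * s i j) =
      (\<Sum>i\<in>V. \<Sum>j\<in>V. t i j) - 2 powr p * (\<Sum>i\<in>V. \<Sum>j\<in>V. s i j)"
    by (simp add: sum_subtractf sum_distrib_left)
  then have "rayleigh V A \<sigma> w \<mu> \<kappa> p f - 2 powr p * frustrated_energy V A \<sigma> w p f =
      (1/2) * (\<Sum>i\<in>V. \<Sum>j\<in>V. t i j - 2 powr p * s i j) + (\<Sum>i\<in>V. \<kappa> i * \<bar>f i\<bar> powr p)"
    using f unfolding rayleigh_def energy_def frustrated_energy_def psphere_def t_def[symmetric] s_def[symmetric]
    by (simp add: algebra_simps)
  also have "\<bar>\<dots>\<bar> \<le> \<bar>(1/2) * (\<Sum>i\<in>V. \<Sum>j\<in>V. t i j - 2 powr p * s i j)\<bar>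
      + \<bar>\<Sum>i\<in>V. \<kappa> i * \<bar>f i\<bar> powr p\<bar>"
    by (rule abs_triangle_ineq)
  also have "\<dots> \<le> edge_bound V A w \<mu> + (\<Sum>i\<in>V. \<bar>\<kappa> i\<bar> / \<mu> i)"
  proof (rule add_mono)
    have "\<bar>\<Sum>i\<in>V. \<Sum>j\<in>V. t i j - 2 powr p * s i j\<bar> \<le>
        (\<Sum>i\<in>V. \<Sum>j\<in>V. if A i j then w i j * (1 / \<mu> i + 1 / \<mu> j) else 0)"
      using ts by (intro order_trans[OF sum_abs] sum_mono) (auto intro!: order_trans[OF sum_abs] sum_mono)
    then show "\<bar>(1/2) * (\<Sum>i\<in>V. \<Sum>j\<in>V. t i j - 2 powr p * s i j)\<bar> \<le> edge_bound V A w \<mu>"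
      by (simp add: edge_bound_def abs_mult)
    show "\<bar>\<Sum>i\<in>V. \<kappa> i * \<bar>f i\<bar> powr p\<bar> \<le> (\<Sum>i\<in>V. \<bar>\<kappa> i\<bar> / \<mu> i)"
      using \<kappa> by (intro order_trans[OF sum_abs] sum_mono)
  qed
  finally show ?thesis .
qed

section \<open>Min-max values of the frustrated energy and their limit\<close>

definition frustrated_eig ::
  "'a set \<Rightarrow> ('a \<Rightarrow> 'a \<Rightarrow> bool) \<Rightarrow> ('a \<Rightarrow> 'a \<Rightarrow> real) \<Rightarrow> ('a \<Rightarrow> 'a \<Rightarrow> real) \<Rightarrow> ('a \<Rightarrow> real)
    \<Rightarrow> real \<Rightarrow> nat \<Rightarrow> real" where
  "frustrated_eig V A \<sigma> w \<mu> p k = (INF B \<in> genus_family V \<mu> p k. SUP f \<in> B. frustrated_energy V A \<sigma> w p f)"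

lemma genus_family_nonempty_members:
  "k \<ge> 1 \<Longrightarrow> B \<in> genus_family V \<mu> p k \<Longrightarrow> B \<noteq> {}"
  unfolding genus_family_def using genus_ge_nonempty by fastforce

lemma genus_family_psphere: "B \<in> genus_family V \<mu> p k \<Longrightarrow> f \<in> B \<Longrightarrow> f \<in> psphere V \<mu> p"
  by (auto simp: genus_family_def)

lemma continuous_on_apply: "continuous_on S (\<lambda>f. f i :: real)"
  by (rule continuous_on_subset[OF continuous_on_product_coordinates]) auto

lemma continuous_on_map_signed_powr:
  assumes "r > 0"
  shows "continuous_on S (\<lambda>f i. signed_powr r (f i))"
  using assms by (intro continuous_on_coordinatewise_then_product continuous_on_signed_powr continuous_on_apply)

lemma signed_powr_in_psphere:
  assumes "0 < p" "0 < q" "f \<in> psphere V \<mu> p"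
  shows "(\<lambda>i. signed_powr (p / q) (f i)) \<in> psphere V \<mu> q"
  using assms by (simp add: psphere_def fspace_def pnorm_mu_def abs_signed_powr powr_powr)

text \<open>The image is closed because it is the preimage of \<open>B\<close> under the inverse
  map, the odd power \<open>q / p\<close>.\<close>

lemma signed_powr_image_genus_family:
  assumes pq: "0 < p" "0 < q" and B: "B \<in> genus_family V \<mu> p k"
  shows "(\<lambda>f i. signed_powr (p / q) (f i)) ` B \<in> genus_family V \<mu> q k"
proof -
  let ?h = "\<lambda>f i. signed_powr (p / q) (f i) :: real"
  have "?h ` B = (\<lambda>f i. signed_powr (q / p) (f i)) -` B"
  proof (intro Set.set_eqI iffI)
    fix f assume "f \<in> (\<lambda>f i. signed_powr (q / p) (f i)) -` B"
    moreover have "f = ?h (\<lambda>i. signed_powr (q / p) (f i))"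
      using pq by (simp add: signed_powr_signed_powr)
    ultimately show "f \<in> ?h ` B" by (metis imageI vimageD)
  qed (use pq in \<open>auto simp: signed_powr_signed_powr\<close>)
  moreover have "closed ((\<lambda>f i. signed_powr (q / p) (f i)) -` B)"
    using B pq by (intro closed_vimage continuous_on_map_signed_powr) (auto simp: genus_family_def)
  ultimately have "closed (?h ` B)" by simp
  moreover have "genus_ge (?h ` B) k"
    using B pq by (intro genus_ge_image continuous_on_map_signed_powr) (auto simp: genus_family_def)
  moreover have "(\<lambda>i. - f i) \<in> ?h ` B" if "f \<in> ?h ` B" for f
  proof -
    obtain g where "g \<in> B" "f = ?h g" using \<open>f \<in> ?h ` B\<close> by blast
    then have "(\<lambda>i. - g i) \<in> B" "(\<lambda>i. - f i) = ?h (\<lambda>i. - g i)"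
      using B by (auto simp: genus_family_def)
    then show ?thesis by (metis imageI)
  qed
  moreover have "?h ` B \<subseteq> psphere V \<mu> q"
    using pq B by (auto simp: genus_family_def intro!: signed_powr_in_psphere)
  ultimately show ?thesis
    by (simp add: genus_family_def)
qed

text \<open>Odd powers preserve signs, so the same edges are frustrated, and
  \<open>mean_powr_antimono\<close> compares their summands.\<close>

lemma frustrated_energy_signed_powr_le:
  assumes G: "signed_graph V A \<sigma> w \<mu>" and pq: "0 < p" "p \<le> q"
  shows "frustrated_energy V A \<sigma> w q (\<lambda>i. signed_powr (p / q) (f i)) \<le> frustrated_energy V A \<sigma> w p f"
  unfolding frustrated_energy_def
proof (intro mult_left_mono sum_mono)
  fix i j
  have "\<sigma> i j * signed_powr (p / q) (f i) * signed_powr (p / q) (f j) < 0 \<longleftrightarrow> \<sigma> i j * f i * f j < 0"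
    by (metis sgn_less sgn_mult sgn_signed_powr)
  moreover have "((\<bar>f i\<bar> powr (p / q) + \<bar>f j\<bar> powr (p / q)) / 2) powr q \<le> ((\<bar>f i\<bar> + \<bar>f j\<bar>) / 2) powr p"
    if "\<sigma> i j * f i * f j < 0"
    using that pq by (intro mean_powr_antimono) auto
  ultimately show "(if A i j \<and> \<sigma> i j * signed_powr (p / q) (f i) * signed_powr (p / q) (f j) < 0
      then w i j * ((\<bar>signed_powr (p / q) (f i)\<bar> + \<bar>signed_powr (p / q) (f j)\<bar>) / 2) powr q else 0)
      \<le> (if A i j \<and> \<sigma> i j * f i * f j < 0 then w i j * ((\<bar>f i\<bar> + \<bar>f j\<bar>) / 2) powr p else 0)"
    using G by (auto simp: abs_signed_powr signed_graph_def less_imp_le intro!: mult_left_mono)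
qed auto

lemma frustrated_energy_abs_le:
  assumes "signed_graph V A \<sigma> w \<mu>" "p \<ge> 0" "f \<in> psphere V \<mu> p"
  shows "\<bar>frustrated_energy V A \<sigma> w p f\<bar> \<le> edge_bound V A w \<mu>"
  using frustrated_energy_nonneg[OF assms(1)] frustrated_energy_le[OF assms(1,3,2)] by simp

lemma frustrated_eig_antimono:
  assumes G: "signed_graph V A \<sigma> w \<mu>" and pq: "0 < p" "p \<le> q" and k: "k \<ge> 1"
    and ne: "genus_family V \<mu> p k \<noteq> {}"
  shows "frustrated_eig V A \<sigma> w \<mu> q k \<le> frustrated_eig V A \<sigma> w \<mu> p k"
proof -
  have "(INF B\<in>genus_family V \<mu> q k. SUP f\<in>B. frustrated_energy V A \<sigma> w q f)
      \<le> 1 * (INF B\<in>genus_family V \<mu> p k. SUP f\<in>B. frustrated_energy V A \<sigma> w p f) + 0"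
  proof (rule minmax_le)
    fix B assume B: "B \<in> genus_family V \<mu> p k"
    show "\<exists>B'\<in>genus_family V \<mu> q k. \<forall>f\<in>B'. \<exists>f'\<in>B.
        frustrated_energy V A \<sigma> w q f \<le> 1 * frustrated_energy V A \<sigma> w p f' + 0"
      using pq frustrated_energy_signed_powr_le[OF G pq]
      by (intro bexI[OF _ signed_powr_image_genus_family[OF _ _ B, of q]]) auto
  next
    fix B f assume "B \<in> genus_family V \<mu> q k" "f \<in> B"
    then show "\<bar>frustrated_energy V A \<sigma> w q f\<bar> \<le> edge_bound V A w \<mu>"
      using G pq by (intro frustrated_energy_abs_le genus_family_psphere) auto
  next
    fix B f assume "B \<in> genus_family V \<mu> p k" "f \<in> B"
    then show "frustrated_energy V A \<sigma> w p f \<le> edge_bound V A w \<mu>"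
      using G pq by (intro frustrated_energy_le genus_family_psphere) auto
  qed (fact ne | erule genus_family_nonempty_members[OF k] | simp)+
  then show ?thesis
    by (simp add: frustrated_eig_def)
qed

lemma frustrated_eig_nonneg:
  assumes G: "signed_graph V A \<sigma> w \<mu>" and "0 < p" and k: "k \<ge> 1"
    and ne: "genus_family V \<mu> p k \<noteq> {}"
  shows "0 \<le> frustrated_eig V A \<sigma> w \<mu> p k"
  unfolding frustrated_eig_def
proof (rule cINF_greatest[OF ne])
  fix B assume B: "B \<in> genus_family V \<mu> p k"
  then obtain f where f: "f \<in> B"
    using genus_family_nonempty_members[OF k B] by blast
  have "0 \<le> frustrated_energy V A \<sigma> w p f"
    by (rule frustrated_energy_nonneg[OF G])
  also have "\<dots> \<le> (SUP f\<in>B. frustrated_energy V A \<sigma> w p f)"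
    using B f \<open>0 < p\<close>
    by (intro cSUP_upper bdd_aboveI2[where M = "edge_bound V A w \<mu>"] frustrated_energy_le[OF G])
      (auto simp: genus_family_def)
  finally show "0 \<le> (SUP f\<in>B. frustrated_energy V A \<sigma> w p f)" .
qed

text \<open>The pointwise estimate \<open>rayleigh_approx\<close> passes through the min-max in both
  directions, its additive error being scaled by \<open>2 powr (- p)\<close>.\<close>

lemma var_eig_approx:
  assumes G: "signed_graph V A \<sigma> w \<mu>" and p: "0 < p" and k: "k \<ge> 1"
    and ne: "genus_family V \<mu> p k \<noteq> {}"
  shows "\<bar>2 powr (- p) * var_eig V A \<sigma> w \<mu> \<kappa> p k - frustrated_eig V A \<sigma> w \<mu> p k\<bar>
       \<le> 2 powr (- p) * (edge_bound V A w \<mu> + (\<Sum>i\<in>V. \<bar>\<kappa> i\<bar> / \<mu> i))"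
proof -
  define C where "C = edge_bound V A w \<mu> + (\<Sum>i\<in>V. \<bar>\<kappa> i\<bar> / \<mu> i)"
  let ?R = "rayleigh V A \<sigma> w \<mu> \<kappa> p" and ?E = "frustrated_energy V A \<sigma> w p" and ?D = "edge_bound V A w \<mu>"
  let ?F = "genus_family V \<mu> p k"
  have approx: "\<bar>?R f - 2 powr p * ?E f\<bar> \<le> C" if "f \<in> psphere V \<mu> p" for f
    unfolding C_def using p that by (intro rayleigh_approx[OF G]) auto
  have E: "\<bar>?E f\<bar> \<le> ?D" if "f \<in> psphere V \<mu> p" for f
    using p that by (intro frustrated_energy_abs_le[OF G]) auto
  have R: "\<bar>?R f\<bar> \<le> C + 2 powr p * ?D" if f: "f \<in> psphere V \<mu> p" for f
  proof -
    have "\<bar>2 powr p * ?E f\<bar> \<le> 2 powr p * ?D"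
      using E[OF f] by (simp add: abs_mult)
    then show ?thesis using approx[OF f] by linarith
  qed
  have cancel: "2 powr (- p) * (2 powr p * x) = x" for x :: real
    by (simp add: powr_minus)
  have le1: "(INF B\<in>?F. SUP f\<in>B. ?R f) \<le> 2 powr p * (INF B\<in>?F. SUP f\<in>B. ?E f) + C"
  proof (rule minmax_le[where K = "C + 2 powr p * ?D" and K' = ?D])
    fix B assume B: "B \<in> ?F"
    show "\<exists>B'\<in>?F. \<forall>f\<in>B'. \<exists>f'\<in>B. ?R f \<le> 2 powr p * ?E f' + C"
      using approx[OF genus_family_psphere[OF B]] by (intro bexI[OF _ B] ballI) (force simp: abs_le_iff)
  next
    show "\<bar>?R f\<bar> \<le> C + 2 powr p * ?D" if "B \<in> ?F" "f \<in> B" for B f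
      using R[OF genus_family_psphere[OF that]] .
    show "?E f \<le> ?D" if "B \<in> ?F" "f \<in> B" for B f
      using E[OF genus_family_psphere[OF that]] by linarith
  qed (fact ne | erule genus_family_nonempty_members[OF k] | simp)+
  have le2: "(INF B\<in>?F. SUP f\<in>B. ?E f) \<le> 2 powr (- p) * (INF B\<in>?F. SUP f\<in>B. ?R f) + 2 powr (- p) * C"
  proof (rule minmax_le[where K = ?D and K' = "C + 2 powr p * ?D"])
    fix B assume B: "B \<in> ?F"
    have "?E f \<le> 2 powr (- p) * ?R f + 2 powr (- p) * C" if "f \<in> B" for f
    proof -
      have "2 powr (- p) * (2 powr p * ?E f) \<le> 2 powr (- p) * (?R f + C)"
        using approx[OF genus_family_psphere[OF B that]] by (intro mult_left_mono) auto
      then show ?thesis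
        unfolding cancel by (simp only: distrib_left)
    qed
    then show "\<exists>B'\<in>?F. \<forall>f\<in>B'. \<exists>f'\<in>B. ?E f \<le> 2 powr (- p) * ?R f' + 2 powr (- p) * C"
      using B by blast
  next
    show "\<bar>?E f\<bar> \<le> ?D" if "B \<in> ?F" "f \<in> B" for B f
      using E[OF genus_family_psphere[OF that]] .
    show "?R f \<le> C + 2 powr p * ?D" if "B \<in> ?F" "f \<in> B" for B f
      using R[OF genus_family_psphere[OF that]] by linarith
  qed (fact ne | erule genus_family_nonempty_members[OF k] | simp)+
  have "2 powr (- p) * (INF B\<in>?F. SUP f\<in>B. ?R f) \<le>
      2 powr (- p) * (2 powr p * (INF B\<in>?F. SUP f\<in>B. ?E f) + C)"
    using le1 by (intro mult_left_mono) auto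
  also have "\<dots> = (INF B\<in>?F. SUP f\<in>B. ?E f) + 2 powr (- p) * C"
    unfolding distrib_left cancel ..
  finally show ?thesis
    using le2 by (simp add: var_eig_def frustrated_eig_def C_def[symmetric] abs_le_iff)
qed

text \<open>The frustrated values decrease in \<open>p\<close> and are nonnegative, so they converge
  to their infimum. The rescaled variational eigenvalues differ from them by a null function, hence
  \<open>Lim\<close> is a true limit and \<kappa> drops out.\<close>

lemma tendsto_cutoff_eig:
  assumes G: "signed_graph V A \<sigma> w \<mu>" and k: "k \<ge> 1"
    and ne: "\<And>p. p > 0 \<Longrightarrow> genus_family V \<mu> p k \<noteq> {}"
  shows "((\<lambda>p. frustrated_eig V A \<sigma> w \<mu> p k) \<longlongrightarrow> cutoff_eig V A \<sigma> w \<mu> \<kappa> k) at_top"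
proof -
  define L where "L = (INF p\<in>{0<..}. frustrated_eig V A \<sigma> w \<mu> p k)"
  let ?g = "\<lambda>p. frustrated_eig V A \<sigma> w \<mu> p k"
  have bdd: "bdd_below (?g ` {0<..})"
    using frustrated_eig_nonneg[OF G _ k ne] by (intro bdd_belowI2[where m = 0]) auto
  have lim: "(?g \<longlongrightarrow> L) at_top"
  proof (rule order_tendstoI)
    fix a assume "a < L"
    have "a < ?g p" if "p > 0" for p
      using cINF_lower[OF bdd, of p] that \<open>a < L\<close> by (simp add: L_def)
    then show "\<forall>\<^sub>F p in at_top. a < ?g p"
      by (rule eventually_mono[OF eventually_gt_at_top[of 0]])
  next
    fix a assume "L < a"
    then obtain p where p: "p > 0" "?g p < a"
      unfolding L_def by (subst (asm) cINF_less_iff[OF _ bdd]) auto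
    have "?g q < a" if "p \<le> q" for q
      using frustrated_eig_antimono[OF G p(1) that k ne[OF p(1)]] p(2) by linarith
    then show "\<forall>\<^sub>F p in at_top. ?g p < a"
      by (rule eventually_mono[OF eventually_ge_at_top[of p]])
  qed
  define C where "C = edge_bound V A w \<mu> + (\<Sum>i\<in>V. \<bar>\<kappa> i\<bar> / \<mu> i)"
  have "((\<lambda>p::real. 2 powr (- p) * C) \<longlongrightarrow> 0) at_top"
  proof -
    have "LIM p at_top. ln 2 * p :: real :> at_top"
      by (rule filterlim_tendsto_pos_mult_at_top[OF tendsto_const]) (auto intro: filterlim_ident)
    then have "LIM p at_top. exp (ln 2 * p) :: real :> at_top"
      by (rule filterlim_compose[OF exp_at_top])
    then have "((\<lambda>p. inverse (exp (ln 2 * p)) :: real) \<longlongrightarrow> 0) at_top"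
      by (rule tendsto_inverse_0_at_top)
    moreover have "2 powr (- p) = inverse (exp (ln 2 * p))" for p :: real
      by (simp add: powr_def mult.commute flip: exp_minus)
    ultimately have "((\<lambda>p::real. 2 powr (- p)) \<longlongrightarrow> 0) at_top"
      by simp
    then show ?thesis
      by (rule tendsto_mult_left_zero)
  qed
  moreover have "\<forall>\<^sub>F p in at_top. norm (2 powr (- p) * var_eig V A \<sigma> w \<mu> \<kappa> p k - ?g p) \<le> 2 powr (- p) * C"
    using var_eig_approx[OF G _ k ne]
    by (auto intro!: eventually_mono[OF eventually_gt_at_top[of 0]] simp: C_def)
  ultimately have "((\<lambda>p. 2 powr (- p) * var_eig V A \<sigma> w \<mu> \<kappa> p k - ?g p) \<longlongrightarrow> 0) at_top"
    by (rule Lim_null_comparison[rotated])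
  from tendsto_add[OF this lim]
  have "((\<lambda>p. 2 powr (- p) * var_eig V A \<sigma> w \<mu> \<kappa> p k) \<longlongrightarrow> L) at_top"
    by simp
  then have "cutoff_eig V A \<sigma> w \<mu> \<kappa> k = L"
    unfolding cutoff_eig_def by (intro tendsto_Lim) auto
  then show ?thesis
    using lim by simp
qed

subsection \<open>Interlacing\<close>

lemma closed_psphere:
  assumes "p > 0"
  shows "closed (psphere V \<mu> p)"
proof -
  have "continuous_on UNIV (pnorm_mu V \<mu> p)"
    unfolding pnorm_mu_def using assms
    by (auto intro!: continuous_on_sum continuous_on_mult continuous_on_const continuous_on_powr'
        continuous_on_rabs continuous_on_apply)
  then have "closed {f. pnorm_mu V \<mu> p f = 1}"
    by (intro closed_Collect_eq continuous_on_const)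
  moreover have "closed (\<Inter>x\<in>-V. {f :: 'a \<Rightarrow> real. f x = 0})"
    by (intro closed_INT ballI closed_Collect_eq continuous_on_const continuous_on_apply)
  moreover have "psphere V \<mu> p = (\<Inter>x\<in>-V. {f. f x = 0}) \<inter> {f. pnorm_mu V \<mu> p f = 1}"
    by (auto simp: psphere_def fspace_def)
  ultimately show ?thesis
    by (simp only: closed_Int)
qed

text \<open>The sphere is closed in a product of compact intervals, which are \<open>{0}\<close> off
  \<open>V\<close>; Tychonoff's theorem applies for any vertex type.\<close>

lemma compact_psphere:
  assumes G: "signed_graph V A \<sigma> w \<mu>" and p: "p > 0"
  shows "compact (psphere V \<mu> p)"
proof -
  define K where "K v = (if v \<in> V then {- ((1 / \<mu> v) powr (1 / p))..(1 / \<mu> v) powr (1 / p)} else {0})" for v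
  have "compactin (powertop_real UNIV) (PiE UNIV K)"
    by (auto simp: compactin_PiE K_def)
  then have "compact (PiE UNIV K)"
    by (simp add: euclidean_product_topology)
  moreover have "psphere V \<mu> p \<subseteq> PiE UNIV K"
  proof
    fix f assume f: "f \<in> psphere V \<mu> p"
    have "\<bar>f v\<bar> \<le> (1 / \<mu> v) powr (1 / p)" if "v \<in> V" for v
    proof -
      have "(\<bar>f v\<bar> powr p) powr (1 / p) \<le> (1 / \<mu> v) powr (1 / p)"
        using psphere_powr_le[OF G f that] p by (intro powr_mono2) auto
      then show ?thesis
        using p by (simp add: powr_powr)
    qed
    then show "f \<in> PiE UNIV K"
      using f by (auto simp: K_def psphere_def fspace_def abs_le_iff minus_le_iff)
  qed
  ultimately show ?thesis
    using closed_psphere[OF p] by (metis closed_Int_compact inf.absorb1)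
qed

section \<open>Passing to an induced subgraph\<close>

lemma signed_graph_induced:
  assumes "signed_graph V A \<sigma> w \<mu>" "V' \<subseteq> V"
  shows "signed_graph V' (induced A V') \<sigma> w \<mu>"
  using assms unfolding signed_graph_def induced_def by (auto intro: finite_subset)

lemma pnorm_mu_subset:
  assumes "finite V" "V' \<subseteq> V" "\<And>v. v \<in> V - V' \<Longrightarrow> f v = 0"
  shows "pnorm_mu V \<mu> p f = pnorm_mu V' \<mu> p f"
  unfolding pnorm_mu_def using assms by (intro sum.mono_neutral_right) auto

text \<open>An edge at a zero of \<open>f\<close> is not frustrated, so edges lost with the removed
  vertices contribute nothing. In the full energy such an edge would leave a term
  \<open>w i j * \<bar>f i\<bar> powr p\<close>.\<close>

lemma frustrated_energy_induced:
  assumes "finite V" "V' \<subseteq> V" "\<And>v. v \<in> V - V' \<Longrightarrow> f v = 0"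
  shows "frustrated_energy V' (induced A V') \<sigma> w p f = frustrated_energy V A \<sigma> w p f"
proof -
  let ?t = "\<lambda>i j. if A i j \<and> \<sigma> i j * f i * f j < 0
      then w i j * ((\<bar>f i\<bar> + \<bar>f j\<bar>) / 2) powr p else 0"
  have "(\<Sum>j\<in>V. ?t i j) = (\<Sum>j\<in>V'. ?t i j)" for i
    using assms by (intro sum.mono_neutral_right) auto
  then have "(\<Sum>i\<in>V. \<Sum>j\<in>V. ?t i j) = (\<Sum>i\<in>V. \<Sum>j\<in>V'. ?t i j)"
    by simp
  also have "\<dots> = (\<Sum>i\<in>V'. \<Sum>j\<in>V'. ?t i j)"
    using assms by (intro sum.mono_neutral_right) (auto intro!: sum.neutral)
  finally show ?thesis
    unfolding frustrated_energy_def induced_def by (auto intro!: sum.cong)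
qed

lemma psphere_subset:
  assumes "finite V" "V' \<subseteq> V"
  shows "psphere V' \<mu> p = {f \<in> psphere V \<mu> p. \<forall>v\<in>V - V'. f v = 0}"
proof -
  have "fspace V' = {f \<in> fspace V. \<forall>v\<in>V - V'. f v = 0}"
    using assms(2) by (auto simp: fspace_def)
  then show ?thesis
    using pnorm_mu_subset[OF assms] by (auto simp: psphere_def)
qed

lemma genus_family_subset:
  assumes "finite V" "V' \<subseteq> V"
  shows "genus_family V' \<mu> p k \<subseteq> genus_family V \<mu> p k"
  unfolding genus_family_def psphere_subset[OF assms] by auto

text \<open>Extension by zero turns every competitor on the subgraph into one on the whole graph
  with the same energy.\<close>

lemma frustrated_eig_le_induced:
  assumes G: "signed_graph V A \<sigma> w \<mu>" and V': "V' \<subseteq> V" and p: "p > 0" and k: "k \<ge> 1"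
    and ne: "genus_family V' \<mu> p k \<noteq> {}"
  shows "frustrated_eig V A \<sigma> w \<mu> p k \<le> frustrated_eig V' (induced A V') \<sigma> w \<mu> p k"
proof -
  have V: "finite V" using G by (simp add: signed_graph_def)
  note G' = signed_graph_induced[OF G V']
  have "(INF B\<in>genus_family V \<mu> p k. SUP f\<in>B. frustrated_energy V A \<sigma> w p f)
      \<le> 1 * (INF B\<in>genus_family V' \<mu> p k. SUP f\<in>B. frustrated_energy V' (induced A V') \<sigma> w p f) + 0"
  proof (rule minmax_le)
    fix B assume B: "B \<in> genus_family V' \<mu> p k"
    have "frustrated_energy V A \<sigma> w p f = frustrated_energy V' (induced A V') \<sigma> w p f" if "f \<in> B" for f
      using genus_family_psphere[OF B that]
      by (intro frustrated_energy_induced[OF V V', symmetric]) (simp add: psphere_subset[OF V V'])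
    then show "\<exists>B'\<in>genus_family V \<mu> p k. \<forall>f\<in>B'. \<exists>f'\<in>B. frustrated_energy V A \<sigma> w p f
        \<le> 1 * frustrated_energy V' (induced A V') \<sigma> w p f' + 0"
      using B genus_family_subset[OF V V'] by (intro bexI[of _ B]) force+
  next
    show "\<bar>frustrated_energy V A \<sigma> w p f\<bar> \<le> edge_bound V A w \<mu>"
      if "B \<in> genus_family V \<mu> p k" "f \<in> B" for B f
      using p by (intro frustrated_energy_abs_le[OF G _ genus_family_psphere[OF that]]) auto
    show "frustrated_energy V' (induced A V') \<sigma> w p f \<le> edge_bound V' (induced A V') w \<mu>"
      if "B \<in> genus_family V' \<mu> p k" "f \<in> B" for B f
      using p by (intro frustrated_energy_le[OF G' genus_family_psphere[OF that]]) auto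
  qed (fact ne | erule genus_family_nonempty_members[OF k] | simp)+
  then show ?thesis
    by (simp add: frustrated_eig_def)
qed

section \<open>Odd extensions and the loss of genus on coordinate hyperplanes\<close>

lemma odd_continuous_extension:
  fixes g :: "('a \<Rightarrow> real) \<Rightarrow> real"
  assumes "compact S" "continuous_on S g" "\<And>f. f \<in> S \<Longrightarrow> (\<lambda>i. - f i) \<in> S"
    and "\<And>f. f \<in> S \<Longrightarrow> g (\<lambda>i. - f i) = - g f"
  obtains h where "continuous_on UNIV h" "\<And>f. f \<in> S \<Longrightarrow> h f = g f" "\<And>f. h (\<lambda>i. - f i) = - h f"
proof -
  \<comment> \<open>An uncountable power of the reals is not normal, but complete regularity
    suffices for extension from a compact set.\<close>
  have "completely_regular_space (powertop_real (UNIV :: 'a set))"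
    by (simp add: completely_regular_space_product_topology metrizable_imp_completely_regular_space
        metrizable_space_euclidean)
  then have "completely_regular_space (euclidean :: ('a \<Rightarrow> real) topology)"
    by (simp add: euclidean_product_topology)
  then obtain G where G: "continuous_map euclidean euclideanreal G" "\<And>f. f \<in> S \<Longrightarrow> G f = g f"
    by (rule Tietze_extension_completely_regular[where T = UNIV and f = g and S = S])
      (use assms(1,2) in auto)
  \<comment> \<open>Antisymmetrising keeps the values on \<open>S\<close>, where \<open>g\<close> is
    odd.\<close>
  define h where "h f = (G f - G (\<lambda>i. - f i)) / 2" for f
  have contG: "continuous_on UNIV G"
    using G(1) by simp
  have "continuous_on UNIV (\<lambda>f :: 'a \<Rightarrow> real. (\<lambda>i. - f i))"
    by (intro continuous_on_coordinatewise_then_product continuous_on_minus continuous_on_apply)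
  then have "continuous_on UNIV h"
    unfolding h_def by (intro continuous_intros contG continuous_on_compose2[OF contG]) auto
  moreover have "h f = g f" if "f \<in> S" for f
    using that assms(3,4) by (simp add: h_def G(2))
  moreover have "h (\<lambda>i. - f i) = - h f" for f
    by (simp add: h_def field_simps)
  ultimately show ?thesis
    using that by blast
qed

text \<open>An odd map to \<open>Rspace j\<close> on the zero set extends oddly to \<open>B\<close>.
  Appending the coordinates \<open>f v\<close> for \<open>v\<close> in \<open>W\<close> removes the
  zeros of the extension, giving an odd map into \<open>Rspace (j + card W)\<close> minus 0.\<close>

lemma genus_ge_zero_on:
  fixes B :: "('a \<Rightarrow> real) set"
  assumes "compact B" "closed B" "\<And>f. f \<in> B \<Longrightarrow> (\<lambda>i. - f i) \<in> B" "finite W"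
    and genus: "genus_ge B (k + card W)"
  shows "genus_ge {f \<in> B. \<forall>v\<in>W. f v = 0} k"
proof -
  let ?C = "{f \<in> B. \<forall>v\<in>W. f v = 0}"
  have "closed (\<Inter>v\<in>W. {f :: 'a \<Rightarrow> real. f v = 0})"
    by (intro closed_INT ballI closed_Collect_eq continuous_on_const continuous_on_apply)
  moreover have "?C = B \<inter> (\<Inter>v\<in>W. {f. f v = 0})"
    by auto
  ultimately have C: "compact ?C"
    using assms(1) by auto
  show ?thesis
    unfolding genus_ge_def
  proof clarify
    fix j and g :: "('a \<Rightarrow> real) \<Rightarrow> nat \<Rightarrow> real"
    assume j: "j < k" and g: "continuous_on ?C g"
      and g_odd: "\<forall>f\<in>?C. g (\<lambda>i. - f i) = (\<lambda>i. - g f i)" and g_nz: "\<forall>f\<in>?C. g f \<in> Rspace j - {\<lambda>_. 0}"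
    have "\<exists>h. continuous_on UNIV h \<and> (\<forall>f\<in>?C. h f = g f i) \<and> (\<forall>f. h (\<lambda>i. - f i) = - h f)" for i
    proof (rule odd_continuous_extension[OF C, of "\<lambda>f. g f i"])
      show "continuous_on ?C (\<lambda>f. g f i)"
        using g by (rule continuous_on_product_then_coordinatewise)
      show "(\<lambda>v. - f v) \<in> ?C" if "f \<in> ?C" for f
        using that assms(3) by auto
      show "g (\<lambda>v. - f v) i = - g f i" if "f \<in> ?C" for f
        using bspec[OF g_odd that] by simp
    qed blast
    then have "\<forall>i. \<exists>h. continuous_on UNIV h \<and> (\<forall>f\<in>?C. h f = g f i) \<and> (\<forall>f. h (\<lambda>i. - f i) = - h f)" ..
    from choice[OF this] obtain h where h: "\<And>i. continuous_on UNIV (h i)"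
      "\<And>i f. f \<in> ?C \<Longrightarrow> h i f = g f i" "\<And>i f. h i (\<lambda>i. - f i) = - h i f"
      by blast
    obtain e where e: "bij_betw e {0..<card W} W"
      using ex_bij_betw_nat_finite[OF assms(4)] by blast
    define H where "H f i = (if i < j then h i f else if i < j + card W then f (e (i - j)) else 0)"
      for f :: "'a \<Rightarrow> real" and i
    have "continuous_on B H"
    proof (rule continuous_on_coordinatewise_then_product)
      fix i
      show "continuous_on B (\<lambda>f. H f i)"
        unfolding H_def
        by (cases "i < j"; cases "i < j + card W")
          (simp_all add: continuous_on_subset[OF h(1)] continuous_on_apply)
    qed
    moreover have "H (\<lambda>i. - f i) = (\<lambda>i. - H f i)" for f
      by (auto simp: H_def h(3))
    moreover have "H f \<in> Rspace (j + card W) - {\<lambda>_. 0}" if f: "f \<in> B" for f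
    proof -
      \<comment> \<open>On \<open>?C\<close> the first block is \<open>g f\<close>; off
        \<open>?C\<close> some appended coordinate is nonzero.\<close>
      have "\<exists>i. H f i \<noteq> 0"
      proof (cases "f \<in> ?C")
        case True
        then obtain i where "g f i \<noteq> 0" using g_nz by fastforce
        moreover from this have "i < j"
          using g_nz True by (force simp: Rspace_def not_less)
        ultimately show ?thesis
          using True h(2) by (auto simp: H_def intro!: exI[of _ i])
      next
        case False
        then obtain v where v: "v \<in> W" "f v \<noteq> 0" using f by auto
        then obtain i where "i < card W" "e i = v"
          using e bij_betw_imp_surj_on[OF e] by (metis atLeastLessThan_iff imageE)
        then show ?thesis
          using v by (auto simp: H_def intro!: exI[of _ "j + i"])
      qed
      moreover have "H f i = 0" if "j + card W \<le> i" for i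
        using that by (simp add: H_def)
      ultimately show ?thesis
        unfolding Rspace_def by force
    qed
    ultimately have "\<exists>h :: ('a \<Rightarrow> real) \<Rightarrow> nat \<Rightarrow> real. continuous_on B h \<and>
        (\<forall>f\<in>B. h (\<lambda>i. - f i) = (\<lambda>i. - h f i)) \<and> (\<forall>f\<in>B. h f \<in> Rspace (j + card W) - {\<lambda>_. 0})"
      by (intro exI[of _ H]) simp
    moreover have "j + card W < k + card W"
      using j by simp
    ultimately show False
      using genus unfolding genus_ge_def by blast
  qed
qed

text \<open>From a competitor on the whole graph, keep the functions vanishing on
  \<open>V - V'\<close>. This costs at most \<open>card (V - V')\<close> in genus and does not
  change their energy.\<close>

lemma frustrated_eig_induced_le:
  assumes G: "signed_graph V A \<sigma> w \<mu>" and V': "V' \<subseteq> V" and p: "p > 0" and k: "k \<ge> 1"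
    and ne: "genus_family V \<mu> p (k + card (V - V')) \<noteq> {}"
  shows "frustrated_eig V' (induced A V') \<sigma> w \<mu> p k \<le> frustrated_eig V A \<sigma> w \<mu> p (k + card (V - V'))"
proof -
  have V: "finite V" using G by (simp add: signed_graph_def)
  note G' = signed_graph_induced[OF G V']
  let ?l = "k + card (V - V')"
  have l: "?l \<ge> 1" using k by simp
  have "(INF B\<in>genus_family V' \<mu> p k. SUP f\<in>B. frustrated_energy V' (induced A V') \<sigma> w p f)
      \<le> 1 * (INF B\<in>genus_family V \<mu> p ?l. SUP f\<in>B. frustrated_energy V A \<sigma> w p f) + 0"
  proof (rule minmax_le)
    fix B assume B: "B \<in> genus_family V \<mu> p ?l"
    let ?C = "{f \<in> B. \<forall>v\<in>V - V'. f v = 0}"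
    have Bp: "B \<subseteq> psphere V \<mu> p" "closed B" "\<And>f. f \<in> B \<Longrightarrow> (\<lambda>i. - f i) \<in> B" "genus_ge B ?l"
      using B by (auto simp: genus_family_def)
    have "compact B"
      using compact_psphere[OF G p] Bp(1,2) by (metis closed_Int_compact inf.absorb1)
    then have "genus_ge ?C k"
      using V Bp by (intro genus_ge_zero_on) auto
    moreover have "closed (\<Inter>v\<in>V - V'. {f :: 'a \<Rightarrow> real. f v = 0})"
      by (intro closed_INT ballI closed_Collect_eq continuous_on_const continuous_on_apply)
    with Bp(2) have "closed (B \<inter> (\<Inter>v\<in>V - V'. {f. f v = 0}))"
      by (rule closed_Int)
    then have "closed ?C"
      by (rule back_subst[of closed]) auto
    ultimately have C: "?C \<in> genus_family V' \<mu> p k"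
      using Bp unfolding genus_family_def psphere_subset[OF V V'] by auto
    have "frustrated_energy V' (induced A V') \<sigma> w p f = frustrated_energy V A \<sigma> w p f" if "f \<in> ?C" for f
      using that by (intro frustrated_energy_induced[OF V V']) auto
    then show "\<exists>B'\<in>genus_family V' \<mu> p k. \<forall>f\<in>B'. \<exists>f'\<in>B.
        frustrated_energy V' (induced A V') \<sigma> w p f \<le> 1 * frustrated_energy V A \<sigma> w p f' + 0"
      by (intro bexI[OF _ C]) force
  next
    show "\<bar>frustrated_energy V' (induced A V') \<sigma> w p f\<bar> \<le> edge_bound V' (induced A V') w \<mu>"
      if "B \<in> genus_family V' \<mu> p k" "f \<in> B" for B f
      using p by (intro frustrated_energy_abs_le[OF G' _ genus_family_psphere[OF that]]) auto
    show "frustrated_energy V A \<sigma> w p f \<le> edge_bound V A w \<mu>"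
      if "B \<in> genus_family V \<mu> p ?l" "f \<in> B" for B f
      using p by (intro frustrated_energy_le[OF G genus_family_psphere[OF that]]) auto
  qed (fact ne | erule genus_family_nonempty_members[OF k] | erule genus_family_nonempty_members[OF l] | simp)+
  then show ?thesis
    by (simp add: frustrated_eig_def)
qed

text \<open>An odd map of the sphere to \<open>Rspace j\<close> without zeros, pulled back to the
  round sphere of dimension \<open>card V - 1\<close>, would contradict
  \<open>Borsuk_Ulam_nsphere\<close>.\<close>

lemma genus_ge_psphere:
  assumes G: "signed_graph V A \<sigma> w \<mu>" and p: "p > 0"
  shows "genus_ge (psphere V \<mu> p) (card V)"
  unfolding genus_ge_def
proof clarify
  fix j and g :: "('a \<Rightarrow> real) \<Rightarrow> nat \<Rightarrow> real"
  assume j: "j < card V" and g: "continuous_on (psphere V \<mu> p) g"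
    and g_odd: "\<forall>f\<in>psphere V \<mu> p. g (\<lambda>i. - f i) = (\<lambda>i. - g f i)"
    and g_nz: "\<forall>f\<in>psphere V \<mu> p. g f \<in> Rspace j - {\<lambda>_. 0}"
  have V: "finite V" and mu: "\<And>v. v \<in> V \<Longrightarrow> \<mu> v > 0"
    using G by (auto simp: signed_graph_def)
  obtain n where n: "card V = Suc n"
    using j by (cases "card V") auto
  obtain e where "bij_betw e V {0..<card V}"
    using ex_bij_betw_finite_nat[OF V] by blast
  then have e: "bij_betw e V {..n}"
    using n by (simp add: atLeast0LessThan lessThan_Suc_atMost)
  \<comment> \<open>The exponents are chosen so that
    \<open>\<mu> v * \<bar>h x v\<bar> powr p\<close> is the square of
    \<open>x (e v)\<close>.\<close>
  define h where "h x v = (if v \<in> V then signed_powr (2 / p) (x (e v)) / \<mu> v powr (1 / p) else 0)"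
    for x :: "nat \<Rightarrow> real" and v
  have top: "topspace (nsphere n) = {x. (\<Sum>i\<le>n. (x i)\<^sup>2) = 1 \<and> (\<forall>i>n. x i = 0)}"
    by (simp add: nsphere)
  have h: "h x \<in> psphere V \<mu> p" if x: "x \<in> topspace (nsphere n)" for x
  proof -
    have "\<mu> v * \<bar>h x v\<bar> powr p = (x (e v))\<^sup>2" if v: "v \<in> V" for v
    proof -
      have "\<bar>h x v\<bar> powr p = (\<bar>x (e v)\<bar> powr (2 / p)) powr p / (\<mu> v powr (1 / p)) powr p"
        using v by (simp add: h_def abs_signed_powr powr_divide)
      also have "\<dots> = (x (e v))\<^sup>2 / \<mu> v"
        using p mu[OF v] by (cases "x (e v) = 0") (simp_all add: powr_powr)
      finally show ?thesis
        using mu[OF v] by simp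
    qed
    then have "pnorm_mu V \<mu> p (h x) = (\<Sum>v\<in>V. (x (e v))\<^sup>2)"
      by (simp add: pnorm_mu_def)
    also have "\<dots> = (\<Sum>i\<le>n. (x i)\<^sup>2)"
      by (rule sum.reindex_bij_betw[OF e])
    finally show ?thesis
      using x by (auto simp: top psphere_def fspace_def h_def)
  qed
  have "continuous_on S h" for S
  proof (rule continuous_on_coordinatewise_then_product)
    fix v
    show "continuous_on S (\<lambda>x. h x v)"
      unfolding h_def using p mu[of v]
      by (cases "v \<in> V") (auto intro!: continuous_on_divide continuous_on_signed_powr continuous_on_apply
          continuous_on_const)
  qed
  then have "continuous_on (topspace (nsphere n)) (g \<circ> h)"
    using h by (intro continuous_on_compose continuous_on_subset[OF g]) auto
  then have cont: "continuous_map (nsphere n) (powertop_real UNIV) (g \<circ> h)"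
    by (simp add: nsphere euclidean_product_topology)
  show False
  proof (rule Borsuk_Ulam_nsphere[OF cont])
    fix x assume x: "x \<in> topspace (nsphere n)"
    have "h (\<lambda>i. - x i) = (\<lambda>v. - h x v)"
      by (auto simp: h_def)
    then show "(g \<circ> h) (\<lambda>i. - x i) = (\<lambda>i. - (g \<circ> h) x i)"
      using g_odd h[OF x] by simp
    have "g (h x) \<in> Rspace j - {\<lambda>_. 0}"
      using g_nz h[OF x] by blast
    then obtain i where "g (h x) i \<noteq> 0" "i < j"
      by (force simp: Rspace_def not_less)
    \<comment> \<open>From \<open>j < card V = Suc n\<close> it follows that
      \<open>j \<le> n\<close>, so the nonzero coordinate is among the first
      \<open>n\<close>.\<close>
    then show "\<exists>i<n. (g \<circ> h) x i \<noteq> 0"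
      using j n by (intro exI[of _ i]) auto
  qed
qed

lemma genus_family_nonempty:
  assumes "signed_graph V A \<sigma> w \<mu>" "p > 0" "k \<le> card V"
  shows "genus_family V \<mu> p k \<noteq> {}"
proof -
  have "psphere V \<mu> p \<in> genus_family V \<mu> p k"
    using genus_ge_mono[OF genus_ge_psphere[OF assms(1,2)] assms(3)] closed_psphere[OF assms(2)]
    by (auto simp: genus_family_def psphere_def fspace_def pnorm_mu_def)
  then show ?thesis by blast
qed

theorem theorem4p6:
  fixes V V' :: "'a set" and A :: "'a \<Rightarrow> 'a \<Rightarrow> bool"
    and \<sigma> w :: "'a \<Rightarrow> 'a \<Rightarrow> real" and \<mu> \<kappa> :: "'a \<Rightarrow> real" and n m k :: nat
  assumes "signed_graph V A \<sigma> w \<mu>"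
    and "card V = n"
    and "V' \<subseteq> V" and "card (V - V') = m"
    and "1 \<le> m" and "m \<le> n - 1"
    and "1 \<le> k" and "k \<le> n - m"
  shows "cutoff_eig V A \<sigma> w \<mu> \<kappa> k \<le> cutoff_eig V' (induced A V') \<sigma> w \<mu> \<kappa> k
       \<and> cutoff_eig V' (induced A V') \<sigma> w \<mu> \<kappa> k \<le> cutoff_eig V A \<sigma> w \<mu> \<kappa> (k + m)"
proof -
  note G = assms(1) and V' = assms(3) and k = \<open>1 \<le> k\<close>
  note G' = signed_graph_induced[OF G V']
  have V: "finite V" using G by (simp add: signed_graph_def)
  have card: "card V' = n - m"
    using V V' assms(2,4) card_Diff_subset[of V' V] card_mono[OF V V'] finite_subset[OF V' V] by linarith
  \<comment> \<open>All three indices are at most the number of vertices, because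
    \<open>k + m \<le> n\<close> and \<open>card V' = n - m\<close>.\<close>
  have ne: "genus_family V \<mu> p k \<noteq> {}" "genus_family V \<mu> p (k + m) \<noteq> {}"
    "genus_family V' \<mu> p k \<noteq> {}" if "p > 0" for p
    using assms card genus_family_nonempty[OF G that] genus_family_nonempty[OF G' that] by auto
  have lim: "((\<lambda>p. frustrated_eig V A \<sigma> w \<mu> p k) \<longlongrightarrow> cutoff_eig V A \<sigma> w \<mu> \<kappa> k) at_top"
    "((\<lambda>p. frustrated_eig V A \<sigma> w \<mu> p (k + m)) \<longlongrightarrow> cutoff_eig V A \<sigma> w \<mu> \<kappa> (k + m)) at_top"
    "((\<lambda>p. frustrated_eig V' (induced A V') \<sigma> w \<mu> p k) \<longlongrightarrow> cutoff_eig V' (induced A V') \<sigma> w \<mu> \<kappa> k) at_top"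
    using tendsto_cutoff_eig[OF G _ ne(1)] tendsto_cutoff_eig[OF G _ ne(2)]
      tendsto_cutoff_eig[OF G' _ ne(3)] k by auto
  \<comment> \<open>Both inequalities hold at every \<open>p > 0\<close> and pass to the
    limit.\<close>
  have "\<forall>\<^sub>F p in at_top. frustrated_eig V A \<sigma> w \<mu> p k \<le> frustrated_eig V' (induced A V') \<sigma> w \<mu> p k"
    using frustrated_eig_le_induced[OF G V' _ k ne(3)]
    by (auto intro!: eventually_mono[OF eventually_gt_at_top[of 0]])
  moreover have "\<forall>\<^sub>F p in at_top. frustrated_eig V' (induced A V') \<sigma> w \<mu> p k \<le> frustrated_eig V A \<sigma> w \<mu> p (k + m)"
    using frustrated_eig_induced_le[OF G V' _ k] ne(2) assms(4)
    by (auto intro!: eventually_mono[OF eventually_gt_at_top[of 0]])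
  ultimately show ?thesis
    using lim by (blast intro: tendsto_le[OF trivial_limit_at_top_linorder])
qed

end
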